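(* For each $n\ge 3$ let $(P_{ij})_{1\le i,j\le n}$ be a random symmetric matrix whose diagonal elements $P_i=P_{ii}$, $i=1,\dots,n$, are i.i.d. uniform on $[0,1]$ and whose off-diagonal elements $P_{ij}=P_{ji}$, $i<j$, are, conditionally on the diagonal, independent with $P_{ij}$ uniform on $[0,\min(P_i,P_j)]$. Let $B_1^*$ and $B_2^*$ be the best (smallest over all orderings) level 1 and level 2 bounds of this matrix. Then $$\lim_{n\to\infty}P\big(B_2^*<B_1^*\big)=1.$$
   Context: For a symmetric matrix $(P_{ij})_{1\le i,j\le n}$ with diagonal entries $P_i=P_{ii}$ and a permutation $\pi$ of $\{1,\dots,n\}$, write $Q_i=P_{\pi(i)}$ and $Q_{ij}=P_{\pi(i)\pi(j)}$. The level 1 and level 2 bounds in the ordering $\pi$ are $$B_1(\pi)=Q_1+Q_2-Q_{12}+\sum_{i=3}^n\Big[Q_i-\max_{1\le j<i}Q_{ji}\Big],$$ $$B_2(\pi)=Q_1+Q_2-Q_{12}+\sum_{i=3}^n\Big[Q_i-\max_{1\le j<l<i}\big\{Q_{ji}+Q_{li}-\min(Q_{ji},Q_{li},Q_{jl})\big\}\Big],$$ and $B_m^*=\min_{\pi}B_m(\pi)$ for $m=1,2$, the minimum being over all $n!$ permutations $\pi$ of $\{1,\dots,n\}$. *)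

theory Defs
  imports "HOL-Probability.Probability" "HOL-Combinatorics.Permutations"
begin

(* Matrices are indexed by {1..n}; entries outside this range are irrelevant. *)

definition level1_bound :: "nat \<Rightarrow> (nat \<Rightarrow> nat \<Rightarrow> real) \<Rightarrow> (nat \<Rightarrow> nat) \<Rightarrow> real" where
  "level1_bound n P \<pi> =
     (let Q = (\<lambda>i j. P (\<pi> i) (\<pi> j)) in
      Q 1 1 + Q 2 2 - Q 1 2 + (\<Sum>i=3..n. Q i i - (MAX j\<in>{1..<i}. Q j i)))"

definition level2_bound :: "nat \<Rightarrow> (nat \<Rightarrow> nat \<Rightarrow> real) \<Rightarrow> (nat \<Rightarrow> nat) \<Rightarrow> real" where
  "level2_bound n P \<pi> =
     (let Q = (\<lambda>i j. P (\<pi> i) (\<pi> j)) in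
      Q 1 1 + Q 2 2 - Q 1 2 +
      (\<Sum>i=3..n. Q i i -
         (MAX (j, l)\<in>{(j, l). 1 \<le> j \<and> j < l \<and> l < i}.
            Q j i + Q l i - min (Q j i) (min (Q l i) (Q j l)))))"

definition best_level1_bound :: "nat \<Rightarrow> (nat \<Rightarrow> nat \<Rightarrow> real) \<Rightarrow> real" where
  "best_level1_bound n P = (MIN \<pi>\<in>{\<pi>. \<pi> permutes {1..n}}. level1_bound n P \<pi>)"

definition best_level2_bound :: "nat \<Rightarrow> (nat \<Rightarrow> nat \<Rightarrow> real) \<Rightarrow> real" where
  "best_level2_bound n P = (MIN \<pi>\<in>{\<pi>. \<pi> permutes {1..n}}. level2_bound n P \<pi>)"

definition cond_prob_given :: "'a measure \<Rightarrow> 'a measure \<Rightarrow> 'a set \<Rightarrow> 'a \<Rightarrow> real" where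
  "cond_prob_given M F A = real_cond_exp M F (indicator A)"

definition has_cond_law ::
    "'a measure \<Rightarrow> 'a measure \<Rightarrow> ('a \<Rightarrow> real) \<Rightarrow> ('a \<Rightarrow> real measure) \<Rightarrow> bool" where
  "has_cond_law M F X K \<longleftrightarrow>
     (\<forall>B\<in>sets borel. AE \<omega> in M.
        cond_prob_given M F {\<omega>\<in>space M. X \<omega> \<in> B} \<omega> = measure (K \<omega>) B)"

definition cond_indep_vars ::
    "'a measure \<Rightarrow> 'a measure \<Rightarrow> ('i \<Rightarrow> 'a \<Rightarrow> real) \<Rightarrow> 'i set \<Rightarrow> bool" where
  "cond_indep_vars M F X I \<longleftrightarrow>
     (\<forall>J B. finite J \<longrightarrow> J \<subseteq> I \<longrightarrow> (\<forall>k\<in>J. B k \<in> sets borel) \<longrightarrow>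
        (AE \<omega> in M.
           cond_prob_given M F {\<omega>\<in>space M. \<forall>k\<in>J. X k \<omega> \<in> B k} \<omega> =
           (\<Prod>k\<in>J. cond_prob_given M F {\<omega>\<in>space M. X k \<omega> \<in> B k} \<omega>)))"

(* The sub-sigma-algebra generated by the diagonal entries. *)
definition diagonal_algebra ::
    "'a measure \<Rightarrow> nat \<Rightarrow> (nat \<Rightarrow> nat \<Rightarrow> 'a \<Rightarrow> real) \<Rightarrow> 'a measure" where
  "diagonal_algebra M n P =
     vimage_algebra (space M) (\<lambda>\<omega>. \<lambda>i\<in>{1..n}. P i i \<omega>) (\<Pi>\<^sub>M i\<in>{1..n}. (borel :: real measure))"

(* In off_diagonal_cond_law, the interval [0, min (P i i) (P j j)] is degenerate only on a null event,
   so the value of uniform_measure there is immaterial. *)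
locale random_matrix = prob_space M
  for M :: "'a measure" and n :: nat and P :: "nat \<Rightarrow> nat \<Rightarrow> 'a \<Rightarrow> real" +
  assumes random_variables:
      "\<And>i j. i \<in> {1..n} \<Longrightarrow> j \<in> {1..n} \<Longrightarrow> P i j \<in> borel_measurable M"
    and symmetric:
      "\<And>i j \<omega>. i \<in> {1..n} \<Longrightarrow> j \<in> {1..n} \<Longrightarrow> \<omega> \<in> space M \<Longrightarrow> P i j \<omega> = P j i \<omega>"
    and diagonal_indep: "indep_vars (\<lambda>_. borel) (\<lambda>i. P i i) {1..n}"
    and diagonal_uniform:
      "\<And>i. i \<in> {1..n} \<Longrightarrow> distr M lborel (P i i) = uniform_measure lborel {0..1}"
    and off_diagonal_cond_indep:
      "cond_indep_vars M (diagonal_algebra M n P) (\<lambda>(i, j). P i j)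
         {(i, j). 1 \<le> i \<and> i < j \<and> j \<le> n}"
    and off_diagonal_cond_law:
      "\<And>i j. 1 \<le> i \<Longrightarrow> i < j \<Longrightarrow> j \<le> n \<Longrightarrow>
         has_cond_law M (diagonal_algebra M n P) (P i j)
           (\<lambda>\<omega>. uniform_measure lborel {0..min (P i i \<omega>) (P j j \<omega>)})"

end

theory Submission
  imports Defs "HOL-Real_Asymp.Real_Asymp"
begin

text \<open>The best level 1 bound is the sum of the diagonal minus the weight of a maximum spanning tree.
  Let \<open>l\<close> be the index of the smallest diagonal entry and suppose that the others exceed
  \<open>r P_l\<close>, for a fixed \<open>r > 1\<close>; this has probability \<open>1 / r\<close>. With high probability any two
  indices other than \<open>l\<close> have a common neighbour at weights above \<open>P_l\<close>, so that \<open>l\<close> is a leaf of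
  every maximum spanning tree, attached to the index \<open>k\<close> that maximises \<open>P_kl\<close>. The rest \<open>T\<close> of the
  tree does not depend on the entries \<open>P_xl = P_l U_xl\<close>, so the second largest of the \<open>U_xl\<close>,
  attained at \<open>i\<close> say, is unlikely to be adjacent to \<open>k\<close> in \<open>T\<close>. Order the indices along the tree
  with \<open>k\<close>, \<open>l\<close> first. The parent \<open>j\<close> of \<open>i\<close> then satisfies \<open>P_jl < P_il\<close>, and the pair \<open>(j, l)\<close>
  gains \<open>P_il - min(P_ij, P_jl) > 0\<close> over the level 1 term of \<open>i\<close>.
  Finally let \<open>r\<close> tend to 1.\<close>

section \<open>Spanning trees\<close>

text \<open>The factor \<open>r\<close> serves the common neighbours. An entry \<open>P_xz\<close>
  exceeds \<open>P_l\<close> once its uniform factor exceeds \<open>P_l / min(P_x, P_z)\<close>, and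
  without a gap this ratio can be arbitrarily close to 1. The gap caps it at \<open>1 / r\<close>,
  so a given pair lacks a heavy common neighbour with probability exponentially small in
  \<open>n\<close>, which survives a union bound over all pairs. The price is that a fixed
  \<open>r\<close> only yields the lower bound \<open>1 / r\<close> in the limit. Randomness is
  revealed in three stages: the diagonal, the entries away from \<open>l\<close>, the column of
  \<open>l\<close>. The tree \<open>T\<close> is fixed before the column is seen. It has fewer than
  \<open>n\<close> edges, whereas a given pair holds the two top places of the column with
  probability of order \<open>1 / n^2\<close>; a union bound over the edges of \<open>T\<close> is
  therefore affordable, one over all pairs is not. In a fixed ordering no level 2 term gains less
  than the level 1 term, because \<open>Q_li\<close> is at least the subtracted minimum. One strict
  gain in one ordering is thus enough, and its size need not be estimated.\<close>

definition edge_connected :: "'a set \<Rightarrow> 'a set set \<Rightarrow> bool" where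
  "edge_connected V T \<longleftrightarrow>
     (\<forall>s::'a \<Rightarrow> bool. (\<forall>x y. {x, y} \<in> T \<longrightarrow> s x = s y) \<longrightarrow> (\<forall>x\<in>V. \<forall>y\<in>V. s x = s y))"

text \<open>Connectivity through two-colourings makes cuts the primitive notion, so that paths are
  never constructed; the edge count \<open>card V - 1\<close> takes the place of acyclicity, so that
  cycles are never handled either.\<close>

definition spanning_tree :: "'a set \<Rightarrow> 'a set set \<Rightarrow> bool" where
  "spanning_tree V T \<longleftrightarrow>
     (\<forall>e\<in>T. \<exists>x\<in>V. \<exists>y\<in>V. x \<noteq> y \<and> e = {x, y}) \<and> edge_connected V T \<and> Suc (card T) = card V"

lemma edge_connectedD:
  fixes s :: "'a \<Rightarrow> bool"
  assumes "edge_connected V T" "\<And>x y. {x, y} \<in> T \<Longrightarrow> s x = s y" "x \<in> V" "y \<in> V"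
  shows "s x = s y"
  using assms unfolding edge_connected_def by blast

lemma spanning_tree_subset_Pow: "spanning_tree V T \<Longrightarrow> T \<subseteq> Pow V"
  unfolding spanning_tree_def by fastforce

lemma spanning_tree_finite: "spanning_tree V T \<Longrightarrow> finite V \<Longrightarrow> finite T"
  by (meson finite_Pow_iff finite_subset spanning_tree_subset_Pow)

lemma spanning_tree_edgeD:
  assumes "spanning_tree V T" "{x, y} \<in> T"
  shows "x \<in> V" "y \<in> V" "x \<noteq> y"
proof -
  obtain a b where "a \<in> V" "b \<in> V" "a \<noteq> b" "{x, y} = {a, b}"
    using assms unfolding spanning_tree_def by blast
  then show "x \<in> V" "y \<in> V" "x \<noteq> y"
    by (auto simp: doubleton_eq_iff)
qed

text \<open>An edge recovers its index as the later of its two ends: if \<open>i\<close> and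
  \<open>j\<close> gave the same edge, each would be the parent of the other and hence
  smaller.\<close>

lemma parent_edges_inj:
  assumes "inj_on f {1..n::nat}" "\<And>i. i \<in> {2..n} \<Longrightarrow> p i \<in> {1..<i}"
  shows "inj_on (\<lambda>i. {f i, f (p i)}) {2..n}"
proof (rule inj_onI, rule ccontr)
  fix i j assume ij: "i \<in> {2..n}" "j \<in> {2..n}" "{f i, f (p i)} = {f j, f (p j)}" "i \<noteq> j"
  have p: "p i \<in> {1..<i}" "p j \<in> {1..<j}" using assms(2) ij by auto
  have "f i \<noteq> f j" using inj_on_eq_iff[OF assms(1), of i j] ij(1,2,4) by simp
  then have "f i = f (p j)" "f (p i) = f j" using ij(3) by (auto simp: doubleton_eq_iff)
  then have "i = p j" "p i = j"
    using inj_on_eq_iff[OF assms(1), of i "p j"] inj_on_eq_iff[OF assms(1), of "p i" j] p ij(1,2)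
    by auto
  then show False using p by auto
qed

lemma parent_edges_connected:
  assumes "f ` {1..n::nat} = V" "\<And>i. i \<in> {2..n} \<Longrightarrow> p i \<in> {1..<i}"
  shows "edge_connected V ((\<lambda>i. {f i, f (p i)}) ` {2..n})"
  unfolding edge_connected_def
proof (intro allI impI ballI)
  fix s x y
  assume s: "\<forall>x y. {x, y} \<in> (\<lambda>i. {f i, f (p i)}) ` {2..n} \<longrightarrow> s x = s y" and xy: "x \<in> V" "y \<in> V"
  have "i \<in> {1..n} \<Longrightarrow> s (f i) = s (f 1)" for i
  proof (induction i rule: less_induct)
    case (less i)
    show ?case
    proof (cases "i = 1")
      case False
      then have i: "i \<in> {2..n}" using less.prems by auto
      have "s (f i) = s (f (p i))" using s i by blast
      moreover have "s (f (p i)) = s (f 1)"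
        using assms(2)[OF i] i by (intro less.IH) auto
      ultimately show ?thesis by simp
    qed simp
  qed
  moreover obtain i j where "x = f i" "y = f j" "i \<in> {1..n}" "j \<in> {1..n}"
    using xy unfolding assms(1)[symmetric] by (elim imageE)
  ultimately show "s x = s y" by metis
qed

lemma parent_edges_spanning_tree:
  assumes "bij_betw f {1..n::nat} V" "1 \<le> n" "\<And>i. i \<in> {2..n} \<Longrightarrow> p i \<in> {1..<i}"
  shows "spanning_tree V ((\<lambda>i. {f i, f (p i)}) ` {2..n})"
proof -
  have inj: "inj_on f {1..n}" and im: "f ` {1..n} = V" using assms(1) by (auto simp: bij_betw_def)
  have "Suc (card ((\<lambda>i. {f i, f (p i)}) ` {2..n})) = card V"
    using card_image[OF parent_edges_inj[OF inj assms(3)]] card_image[OF inj] im assms(2) by simp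
  moreover have "\<exists>x\<in>V. \<exists>y\<in>V. x \<noteq> y \<and> {f i, f (p i)} = {x, y}" if i: "i \<in> {2..n}" for i
  proof -
    have "i \<in> {1..n}" "p i \<in> {1..n}" "i \<noteq> p i" using i assms(3)[OF i] by auto
    moreover have "f i \<in> V" "f (p i) \<in> V" using calculation im by blast+
    ultimately have "f i \<in> V" "f (p i) \<in> V" "f i \<noteq> f (p i)" using inj by (simp_all only: inj_on_eq_iff simp_thms)
    then show ?thesis by blast
  qed
  moreover have "edge_connected V ((\<lambda>i. {f i, f (p i)}) ` {2..n})"
    using im assms(3) by (rule parent_edges_connected)
  ultimately show ?thesis
    unfolding spanning_tree_def by (intro conjI ballI) (erule imageE, hypsubst)
qed

text \<open>Greedy growth. Membership in the current list is a two-colouring; unless the list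
  exhausts \<open>V\<close>, it is not constant there, so some edge of \<open>T\<close> crosses and
  its outer end is appended. The starting list is left general so that an ordering can begin with a
  prescribed pair.\<close>

lemma edge_connected_extend_order:
  assumes "finite V" "edge_connected V T" "\<forall>e\<in>T. e \<subseteq> V" "distinct xs" "xs \<noteq> []" "set xs \<subseteq> V"
  shows "\<exists>ys. distinct (xs @ ys) \<and> set (xs @ ys) = V \<and>
    (\<forall>m. length xs \<le> m \<and> m < length (xs @ ys) \<longrightarrow> (\<exists>q<m. {(xs @ ys) ! m, (xs @ ys) ! q} \<in> T))"
  using assms(4-6)
proof (induction "card (V - set xs)" arbitrary: xs rule: less_induct)
  case less
  show ?case
  proof (cases "set xs = V")
    case True
    then show ?thesis using less.prems by (intro exI[of _ "[]"]) auto
  next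
    case False
    then obtain v where v: "v \<in> V" "v \<notin> set xs" using less.prems by blast
    have "hd xs \<in> V" using less.prems by auto
    then have "\<not> (\<forall>x y. {x, y} \<in> T \<longrightarrow> (x \<in> set xs) = (y \<in> set xs))"
      using edge_connectedD[OF assms(2), of "\<lambda>x. x \<in> set xs" "hd xs" v] v less.prems by auto
    then obtain x y where xy: "{x, y} \<in> T" "x \<in> set xs" "y \<notin> set xs"
      by (metis insert_commute)
    have y: "y \<in> V" using xy assms(3) by auto
    have "card (V - set (xs @ [y])) < card (V - set xs)"
      using y xy assms(1) by (intro psubset_card_mono) auto
    moreover have "distinct (xs @ [y])" "xs @ [y] \<noteq> []" "set (xs @ [y]) \<subseteq> V"
      using less.prems xy y by auto
    ultimately obtain ys where ys: "distinct ((xs @ [y]) @ ys)" "set ((xs @ [y]) @ ys) = V"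
      "\<And>m. length (xs @ [y]) \<le> m \<Longrightarrow> m < length ((xs @ [y]) @ ys)
         \<Longrightarrow> \<exists>q<m. {((xs @ [y]) @ ys) ! m, ((xs @ [y]) @ ys) ! q} \<in> T"
      using less.hyps[of "xs @ [y]"] by blast
    have "\<exists>q<m. {(xs @ y # ys) ! m, (xs @ y # ys) ! q} \<in> T"
      if m: "length xs \<le> m" "m < length (xs @ y # ys)" for m
    proof (cases "m = length xs")
      case True
      obtain q where q: "q < length xs" "xs ! q = x" using xy(2) by (metis in_set_conv_nth)
      then have "{(xs @ y # ys) ! m, (xs @ y # ys) ! q} = {x, y}"
        using True by (auto simp: nth_append)
      then show ?thesis using q True xy(1) by auto
    next
      case False
      then show ?thesis using ys(3)[of m] m by simp
    qed
    moreover have "distinct (xs @ y # ys)" "set (xs @ y # ys) = V" using ys(1,2) by auto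
    ultimately show ?thesis by blast
  qed
qed

text \<open>In an ordering grown from one vertex, each later vertex has its own parent edge. The
  bound is what shows that a spanning tree falls apart when an edge is removed.\<close>

lemma edge_connected_card_le:
  assumes "finite V" "edge_connected V T" "\<forall>e\<in>T. e \<subseteq> V" "finite T"
  shows "card V \<le> Suc (card T)"
proof (cases "V = {}")
  case False
  then obtain v where v: "v \<in> V" by blast
  have "distinct [v]" "[v] \<noteq> []" "set [v] \<subseteq> V" using v by auto
  then obtain ys where ys: "distinct ([v] @ ys)" "set ([v] @ ys) = V"
    "\<And>m. length [v] \<le> m \<Longrightarrow> m < length ([v] @ ys) \<Longrightarrow> \<exists>q<m. {([v] @ ys) ! m, ([v] @ ys) ! q} \<in> T"
    using edge_connected_extend_order[OF assms(1-3), of "[v]"] by blast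
  define f where "f i = ([v] @ ys) ! (i - 1)" for i
  have len: "length ([v] @ ys) = card V" using distinct_card[OF ys(1)] ys(2) by simp
  have inj: "inj_on f {1..card V}"
    unfolding f_def using ys(1) len by (intro inj_onI) (auto simp: nth_eq_iff_index_eq)
  have "\<forall>i\<in>{2..card V}. \<exists>p. p \<in> {1..<i} \<and> {f i, f p} \<in> T"
  proof
    fix i assume i: "i \<in> {2..card V}"
    have "length [v] \<le> i - 1" "i - 1 < length ([v] @ ys)"
      using i unfolding len by auto
    then obtain q where "q < i - 1" "{([v] @ ys) ! (i - 1), ([v] @ ys) ! q} \<in> T"
      using ys(3)[of "i - 1"] by blast
    then show "\<exists>p. p \<in> {1..<i} \<and> {f i, f p} \<in> T"
      using i by (intro exI[of _ "Suc q"]) (auto simp: f_def)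
  qed
  then obtain p where p: "\<And>i. i \<in> {2..card V} \<Longrightarrow> p i \<in> {1..<i} \<and> {f i, f (p i)} \<in> T" by metis
  have "inj_on (\<lambda>i. {f i, f (p i)}) {2..card V}" using p by (intro parent_edges_inj[OF inj]) auto
  then have "card {2..card V} \<le> card T"
    using p assms(4) by (intro card_inj_on_le) auto
  then show ?thesis by simp
qed auto

text \<open>The bridge from trees back to orderings: the parent edges are distinct members of
  \<open>T\<close>, and there are as many of them as \<open>T\<close> has edges, so they exhaust
  \<open>T\<close>.\<close>

lemma spanning_tree_ordering:
  assumes "finite V" "spanning_tree V T" "{k, l} \<in> T"
  obtains f p where "bij_betw f {1..card V} V" "f 1 = k" "f 2 = l"
    "\<And>i. i \<in> {2..card V} \<Longrightarrow> p i \<in> {1..<i}"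
    "bij_betw (\<lambda>i. {f i, f (p i)}) {2..card V} T"
proof -
  have kl: "k \<in> V" "l \<in> V" "k \<noteq> l" using spanning_tree_edgeD[OF assms(2,3)] by auto
  have T: "edge_connected V T" "\<forall>e\<in>T. e \<subseteq> V" "finite T" "Suc (card T) = card V"
    using assms spanning_tree_subset_Pow[OF assms(2)] spanning_tree_finite[OF assms(2)]
    by (auto simp: spanning_tree_def)
  have "distinct [k, l]" "[k, l] \<noteq> []" "set [k, l] \<subseteq> V" using kl by auto
  then obtain ys where ys: "distinct ([k, l] @ ys)" "set ([k, l] @ ys) = V"
    "\<And>m. length [k, l] \<le> m \<Longrightarrow> m < length ([k, l] @ ys) \<Longrightarrow> \<exists>q<m. {([k, l] @ ys) ! m, ([k, l] @ ys) ! q} \<in> T"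
    using edge_connected_extend_order[OF assms(1) T(1,2), of "[k, l]"] by blast
  define f where "f i = ([k, l] @ ys) ! (i - 1)" for i
  have len: "length ([k, l] @ ys) = card V" using distinct_card[OF ys(1)] ys(2) by simp
  have inj: "inj_on f {1..card V}"
    unfolding f_def using ys(1) len by (intro inj_onI) (auto simp: nth_eq_iff_index_eq)
  have fV: "f i \<in> V" if "i \<in> {1..card V}" for i
  proof -
    have "f i \<in> set ([k, l] @ ys)" unfolding f_def using that len by (intro nth_mem) auto
    then show ?thesis unfolding ys(2) .
  qed
  have "card (f ` {1..card V}) = card V" using card_image[OF inj] by simp
  then have "f ` {1..card V} = V"
    using fV assms(1) by (intro card_subset_eq) blast+
  then have bij: "bij_betw f {1..card V} V"
    unfolding bij_betw_def using inj by blast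
  have "\<forall>i\<in>{2..card V}. \<exists>p. p \<in> {1..<i} \<and> {f i, f p} \<in> T"
  proof
    fix i assume i: "i \<in> {2..card V}"
    \<comment> \<open>Position 2 belongs to the starting list, about which the extension says
      nothing; its parent edge is the given \<open>{k, l}\<close>.\<close>
    have "\<exists>q<i - 1. {([k, l] @ ys) ! (i - 1), ([k, l] @ ys) ! q} \<in> T"
    proof (cases "i = 2")
      case True
      then show ?thesis using assms(3) by (auto simp: insert_commute)
    next
      case False
      then have "length [k, l] \<le> i - 1" "i - 1 < length ([k, l] @ ys)"
        using i unfolding len by auto
      then show ?thesis using ys(3)[of "i - 1"] by blast
    qed
    then obtain q where "q < i - 1" "{([k, l] @ ys) ! (i - 1), ([k, l] @ ys) ! q} \<in> T" by blast
    then show "\<exists>p. p \<in> {1..<i} \<and> {f i, f p} \<in> T"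
      using i by (intro exI[of _ "Suc q"]) (auto simp: f_def)
  qed
  then obtain p where p: "\<And>i. i \<in> {2..card V} \<Longrightarrow> p i \<in> {1..<i} \<and> {f i, f (p i)} \<in> T" by metis
  have injE: "inj_on (\<lambda>i. {f i, f (p i)}) {2..card V}" using p by (intro parent_edges_inj[OF inj]) auto
  have "card ((\<lambda>i. {f i, f (p i)}) ` {2..card V}) = card T"
    using card_image[OF injE] T(4) by simp
  then have "(\<lambda>i. {f i, f (p i)}) ` {2..card V} = T"
    using p T(3) by (intro card_subset_eq) blast+
  then have "bij_betw (\<lambda>i. {f i, f (p i)}) {2..card V} T"
    unfolding bij_betw_def using injE by blast
  moreover have "f 1 = k" "f 2 = l" by (simp_all add: f_def)
  ultimately show ?thesis using that bij p by blast
qed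

text \<open>By the edge count, \<open>T\<close> without \<open>{a, l}\<close> is disconnected, so a
  colouring \<open>s\<close> that is not constant on \<open>V\<close> respects it and names the two
  sides of the cut. Any edge across the cut restores both connectivity and the edge count.\<close>

lemma spanning_tree_exchange:
  assumes "finite V" "spanning_tree V T" "{a, l} \<in> T"
  obtains s :: "'a \<Rightarrow> bool" where "s a" "\<not> s l" "\<And>x y. {x, y} \<in> T - {{a, l}} \<Longrightarrow> s x = s y"
    "\<And>c d. c \<in> V \<Longrightarrow> d \<in> V \<Longrightarrow> s c \<noteq> s d \<Longrightarrow> spanning_tree V (insert {c, d} (T - {{a, l}}))"
proof -
  let ?T = "T - {{a, l}}"
  have al: "a \<in> V" "l \<in> V" "a \<noteq> l" using spanning_tree_edgeD[OF assms(2,3)] by auto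
  have T: "edge_connected V T" "\<forall>e\<in>T. e \<subseteq> V" "finite T" "Suc (card T) = card V"
    using assms spanning_tree_subset_Pow[OF assms(2)] spanning_tree_finite[OF assms(2)]
    by (auto simp: spanning_tree_def)
  have card: "Suc (card ?T) = card T" using T(3) assms(3) by (rule card_Suc_Diff1)
  have "\<not> edge_connected V ?T"
    using edge_connected_card_le[OF assms(1), of ?T] T card by auto
  then have "\<exists>s. (\<forall>x y. {x, y} \<in> ?T \<longrightarrow> s x = s y) \<and> \<not> (\<forall>x\<in>V. \<forall>y\<in>V. s x = (s y :: bool))"
    unfolding edge_connected_def by (simp only: not_all not_imp)
  then obtain s0 x0 y0 where s0: "\<And>x y. {x, y} \<in> ?T \<Longrightarrow> s0 x = s0 y" "x0 \<in> V" "y0 \<in> V" "s0 x0 \<noteq> (s0 y0 :: bool)"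
    by metis
  have "s0 a \<noteq> s0 l"
  proof
    assume eq: "s0 a = s0 l"
    have "s0 x = s0 y" if "{x, y} \<in> T" for x y
      using that s0(1)[of x y] eq by (cases "{x, y} = {a, l}") (auto simp: doubleton_eq_iff)
    then have "s0 x0 = s0 y0" using edge_connectedD[OF T(1)] s0(2,3) by blast
    then show False using s0(4) by blast
  qed
  define s where "s x \<longleftrightarrow> s0 x = s0 a" for x
  have s: "s a" "\<not> s l" and sT: "\<And>x y. {x, y} \<in> ?T \<Longrightarrow> s x = s y"
    using s0(1) \<open>s0 a \<noteq> s0 l\<close> by (auto simp: s_def)
  have "spanning_tree V (insert {c, d} ?T)" if cd: "c \<in> V" "d \<in> V" "s c \<noteq> s d" for c d
  proof -
    have "edge_connected V (insert {c, d} ?T)"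
      unfolding edge_connected_def
    proof (intro allI impI)
      fix r :: "'a \<Rightarrow> bool"
      assume r: "\<forall>x y. {x, y} \<in> insert {c, d} ?T \<longrightarrow> r x = r y"
      \<comment> \<open>If \<open>r\<close> differs at \<open>a\<close> and \<open>l\<close>, its
        exclusive disjunction with \<open>s\<close> repairs the defect, since \<open>{a, l}\<close>
        is the only edge of \<open>T\<close> along which \<open>s\<close> changes. Either way
        \<open>q\<close> respects all of \<open>T\<close> and is constant on \<open>V\<close>; the
        new edge \<open>{c, d}\<close> then excludes the second case.\<close>
      define q where "q x \<longleftrightarrow> (if r a = r l then r x else r x \<noteq> s x)" for x
      have "q x = q y" if xy: "{x, y} \<in> T" for x y
      proof (cases "{x, y} = {a, l}")
        case True
        then show ?thesis using s by (auto simp: q_def doubleton_eq_iff)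
      next
        case False
        then show ?thesis using r sT[of x y] xy by (auto simp: q_def)
      qed
      then have const: "q x = q y" if "x \<in> V" "y \<in> V" for x y
        using edge_connectedD[OF T(1)] that by blast
      have "r c = r d" using r by auto
      then have "r a = r l" using const[OF cd(1,2)] cd(3) by (auto simp: q_def split: if_splits)
      then have "q = r" by (simp add: q_def fun_eq_iff)
      then show "\<forall>x\<in>V. \<forall>y\<in>V. r x = r y" using const by metis
    qed
    moreover have "{c, d} \<notin> ?T" using sT[of c d] cd by blast
    then have "Suc (card (insert {c, d} ?T)) = card V" using card T by simp
    moreover have "\<exists>x\<in>V. \<exists>y\<in>V. x \<noteq> y \<and> e = {x, y}" if "e \<in> insert {c, d} ?T" for e
    proof (cases "e = {c, d}")
      case True
      moreover have "c \<noteq> d" using cd(3) by auto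
      ultimately show ?thesis using cd(1,2) by blast
    next
      case False
      then have "e \<in> T" using that by blast
      then show ?thesis using assms(2) unfolding spanning_tree_def by (elim conjE) (rule bspec)
    qed
    ultimately show ?thesis unfolding spanning_tree_def by (intro conjI ballI)
  qed
  with s sT show ?thesis using that by metis
qed

lemma spanning_tree_delete_leaf:
  assumes "finite V" "spanning_tree V T" "{k, l} \<in> T" "\<And>x. {x, l} \<in> T \<Longrightarrow> x = k"
  shows "spanning_tree (V - {l}) (T - {{k, l}})"
proof -
  have kl: "k \<in> V" "l \<in> V" "k \<noteq> l" using spanning_tree_edgeD[OF assms(2,3)] by auto
  have T: "edge_connected V T" "finite T" "Suc (card T) = card V"
    using assms spanning_tree_finite[OF assms(2)] by (auto simp: spanning_tree_def)
  have "edge_connected (V - {l}) (T - {{k, l}})"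
    unfolding edge_connected_def
  proof (intro allI impI)
    fix s :: "'a \<Rightarrow> bool"
    assume s: "\<forall>x y. {x, y} \<in> T - {{k, l}} \<longrightarrow> s x = s y"
    \<comment> \<open>The value of \<open>s\<close> at \<open>l\<close> is unconstrained, so it is
      replaced by the colour of the only neighbour of \<open>l\<close>.\<close>
    have "(s(l := s k)) x = (s(l := s k)) y" if xy: "{x, y} \<in> T" for x y
    proof (cases "x = l \<or> y = l")
      case True
      then show ?thesis
        using assms(4)[of x] assms(4)[of y] xy by (auto simp: insert_commute)
    next
      case False
      then have "{x, y} \<in> T - {{k, l}}" using xy by (auto simp: doubleton_eq_iff)
      then show ?thesis using s False by auto
    qed
    then have "(s(l := s k)) x = (s(l := s k)) y" if "x \<in> V" "y \<in> V" for x y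
      using edge_connectedD[OF T(1)] that by blast
    then show "\<forall>x\<in>V - {l}. \<forall>y\<in>V - {l}. s x = s y" by (metis DiffE fun_upd_other insertI1)
  qed
  moreover have "Suc (card (T - {{k, l}})) = card (V - {l})"
    using T(2,3) kl(2) assms(1,3) by (metis card_Suc_Diff1 Suc_inject)
  moreover have "\<exists>x\<in>V - {l}. \<exists>y\<in>V - {l}. x \<noteq> y \<and> e = {x, y}" if "e \<in> T - {{k, l}}" for e
  proof -
    have "e \<in> T" using that by blast
    then obtain x y where xy: "e = {x, y}" "x \<in> V" "y \<in> V" "x \<noteq> y"
      using assms(2) unfolding spanning_tree_def by blast
    have "x \<noteq> l \<and> y \<noteq> l"
      using assms(4)[of x] assms(4)[of y] xy(1) that by (auto simp: insert_commute)
    then show ?thesis using xy by blast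
  qed
  ultimately show ?thesis unfolding spanning_tree_def by (intro conjI ballI)
qed

lemma spanning_tree_attach_leaf:
  assumes "finite V" "spanning_tree V T" "k \<in> V" "l \<notin> V"
  shows "spanning_tree (insert l V) (insert {k, l} T)"
proof -
  have T: "edge_connected V T" "finite T" "Suc (card T) = card V" "T \<subseteq> Pow V"
    using assms spanning_tree_finite[OF assms(2)] spanning_tree_subset_Pow[OF assms(2)]
    by (auto simp: spanning_tree_def)
  have "{k, l} \<notin> T" using T(4) assms(4) by auto
  then have "Suc (card (insert {k, l} T)) = card (insert l V)" using T assms by simp
  moreover have "edge_connected (insert l V) (insert {k, l} T)"
    unfolding edge_connected_def
  proof (intro allI impI ballI)
    fix s :: "'a \<Rightarrow> bool" and x y
    assume s: "\<forall>x y. {x, y} \<in> insert {k, l} T \<longrightarrow> s x = s y" and xy: "x \<in> insert l V" "y \<in> insert l V"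
    have kl: "s k = s l" using s by auto
    have "s x = s k" if "x \<in> insert l V" for x
      using that edge_connectedD[OF T(1), of s x k] s kl assms(3) by auto
    then show "s x = s y" using xy by blast
  qed
  moreover have "\<exists>x\<in>insert l V. \<exists>y\<in>insert l V. x \<noteq> y \<and> e = {x, y}" if "e \<in> insert {k, l} T" for e
  proof (cases "e = {k, l}")
    case True
    moreover have "k \<noteq> l" using assms(3,4) by blast
    ultimately show ?thesis using assms(3) by blast
  next
    case False
    then have "e \<in> T" using that by blast
    then obtain x y where "e = {x, y}" "x \<in> V" "y \<in> V" "x \<noteq> y"
      using assms(2) unfolding spanning_tree_def by blast
    then show ?thesis by blast
  qed
  ultimately show ?thesis unfolding spanning_tree_def by (intro conjI ballI)
qed

lemma spanning_tree_exists:
  assumes "finite V" "v \<in> V"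
  shows "\<exists>T. spanning_tree V T"
  using assms
proof (induction "card V" arbitrary: V)
  case (Suc n)
  show ?case
  proof (cases "V = {v}")
    case True
    then show ?thesis
      by (intro exI[of _ "{}"]) (simp add: spanning_tree_def edge_connected_def)
  next
    case False
    then obtain w where w: "w \<in> V" "w \<noteq> v" using Suc.prems by blast
    moreover have "n = card (V - {w})"
      using Suc.hyps(2) Suc.prems(1) w(1) by (metis card_Suc_Diff1 Suc_inject)
    ultimately obtain T where "spanning_tree (V - {w}) T"
      using Suc.hyps(1)[of "V - {w}"] Suc.prems by blast
    then have "spanning_tree (insert w (V - {w})) (insert {v, w} T)"
      using w Suc.prems by (intro spanning_tree_attach_leaf) auto
    then show ?thesis using w by (auto simp: insert_absorb)
  qed
qed auto

section \<open>Maximum spanning trees with a light vertex\<close>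

definition max_spanning_tree :: "('a set \<Rightarrow> real) \<Rightarrow> 'a set \<Rightarrow> 'a set set \<Rightarrow> bool" where
  "max_spanning_tree w V T \<longleftrightarrow>
     spanning_tree V T \<and> (\<forall>T'. spanning_tree V T' \<longrightarrow> sum w T' \<le> sum w T)"

lemma max_spanning_tree_exists:
  assumes "finite V" "V \<noteq> {}"
  shows "\<exists>T. max_spanning_tree w V T"
proof -
  let ?S = "{T. spanning_tree V T}"
  have "?S \<subseteq> Pow (Pow V)" using spanning_tree_subset_Pow by blast
  then have fin: "finite ?S" using assms(1) by (simp add: finite_subset)
  obtain v where "v \<in> V" using assms(2) by blast
  then have ne: "?S \<noteq> {}" using spanning_tree_exists[OF assms(1)] by simp
  have "Max (sum w ` ?S) \<in> sum w ` ?S" using fin ne by (intro Max_in) auto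
  then obtain T where T: "spanning_tree V T" "sum w T = Max (sum w ` ?S)"
    by (metis imageE mem_Collect_eq)
  have "sum w T' \<le> sum w T" if "spanning_tree V T'" for T'
    unfolding T(2) using fin that by (intro Max_ge finite_imageI imageI) simp_all
  then show ?thesis unfolding max_spanning_tree_def using T(1) by blast
qed

text \<open>If \<open>l\<close> had two neighbours \<open>a\<close>, \<open>b\<close> in a maximum spanning tree, the edge \<open>{a, l}\<close>
  could be exchanged for one of the two edges on the path through a common heavy neighbour of
  \<open>a\<close> and \<open>b\<close>.\<close>

lemma spanning_tree_weight_le:
  fixes w :: "'a set \<Rightarrow> real"
  assumes "finite V" "l \<in> V" "spanning_tree V T" "max_spanning_tree w (V - {l}) T'"
    and light: "\<And>x. x \<in> V - {l} \<Longrightarrow> w {x, l} \<le> m"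
    and heavy: "\<And>x y. x \<in> V - {l} \<Longrightarrow> y \<in> V - {l} \<Longrightarrow> x \<noteq> y \<Longrightarrow>
       \<exists>z\<in>V - {l}. w {x, z} > m \<and> w {y, z} > m"
    and top: "\<And>x. x \<in> V - {l} \<Longrightarrow> w {x, l} \<le> t"
    and "V \<noteq> {l}"
  shows "sum w T \<le> sum w T' + t"
proof -
  obtain T0 where T0: "spanning_tree V T0" "\<And>T'. spanning_tree V T' \<Longrightarrow> sum w T' \<le> sum w T0"
    using max_spanning_tree_exists[of V w] assms(1,2) unfolding max_spanning_tree_def by blast
  have fin: "finite T0" using spanning_tree_finite T0 assms(1) by blast
  obtain v where v: "v \<in> V" "v \<noteq> l" using assms(2,8) by blast
  have "\<not> (\<forall>x y. {x, y} \<in> T0 \<longrightarrow> (x = l) = (y = l))"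
    using edge_connectedD[of V T0 "\<lambda>x. x = l" v l] T0(1) v assms(2) unfolding spanning_tree_def by auto
  then obtain k where k: "{k, l} \<in> T0" by (metis insert_commute)
  have uniq: "b = k" if b: "{b, l} \<in> T0" for b
  proof (rule ccontr)
    assume "b \<noteq> k"
    have V: "k \<in> V - {l}" "b \<in> V - {l}"
      using spanning_tree_edgeD[OF T0(1) k] spanning_tree_edgeD[OF T0(1) b] by auto
    obtain s where s: "s k" "\<not> s l" "\<And>x y. {x, y} \<in> T0 - {{k, l}} \<Longrightarrow> s x = s y"
      "\<And>c d. c \<in> V \<Longrightarrow> d \<in> V \<Longrightarrow> s c \<noteq> s d \<Longrightarrow> spanning_tree V (insert {c, d} (T0 - {{k, l}}))"
      using spanning_tree_exchange[OF assms(1) T0(1) k] by blast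
    \<comment> \<open>The edge \<open>{b, l}\<close> survives the removal of \<open>{k, l}\<close>,
      so \<open>b\<close> is on the side of \<open>l\<close>, and the path from \<open>k\<close>
      through \<open>z\<close> to \<open>b\<close> has to cross the cut.\<close>
    have "\<not> s b" using s(2) s(3)[of b l] b \<open>b \<noteq> k\<close> by (auto simp: doubleton_eq_iff)
    obtain z where z: "z \<in> V - {l}" "w {k, z} > m" "w {b, z} > m"
      using heavy[OF V] \<open>b \<noteq> k\<close> by blast
    obtain c where c: "c \<in> V" "s c \<noteq> s z" "w {c, z} > m"
      using z s(1) \<open>\<not> s b\<close> V by (cases "s z") blast+
    have new: "{c, z} \<notin> T0 - {{k, l}}" using s(3)[of c z] c by blast
    have "sum w (insert {c, z} (T0 - {{k, l}})) = w {c, z} + (sum w T0 - w {k, l})"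
      using new fin k by (simp add: sum_diff1)
    also have "\<dots> > sum w T0" using c(3) light[OF V(1)] by linarith
    finally show False using T0(2)[OF s(4)[of c z]] c z by fastforce
  qed
  have kV: "k \<in> V - {l}" using spanning_tree_edgeD[OF T0(1) k] by auto
  have "sum w T \<le> sum w T0" using T0 assms(3) by blast
  also have "\<dots> = w {k, l} + sum w (T0 - {{k, l}})" using fin k by (simp add: sum.remove)
  also have "\<dots> \<le> t + sum w T'"
    using top[OF kV] spanning_tree_delete_leaf[OF assms(1) T0(1) k uniq] assms(4)
    unfolding max_spanning_tree_def by (intro add_mono) auto
  finally show ?thesis by simp
qed

section \<open>Level 1 and level 2 bounds of a fixed matrix\<close>

text \<open>Reading the ends in increasing order turns the matrix into a function of unordered
  edges; for symmetric entries the order is immaterial.\<close>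

definition edge_weight :: "(nat \<Rightarrow> nat \<Rightarrow> real) \<Rightarrow> nat set \<Rightarrow> real" where
  "edge_weight X e = X (Min e) (Max e)"

lemma edge_weight_doubleton:
  assumes "X i j = X j i"
  shows "edge_weight X {i, j} = X i j"
  using assms by (cases "i \<le> j") (auto simp: edge_weight_def min_def max_def)

lemma sum_split_first_two:
  fixes g :: "nat \<Rightarrow> real"
  assumes "2 \<le> n"
  shows "sum g {1..n} = g 1 + g 2 + sum g {3..n}" "sum g {2..n} = g 2 + sum g {3..n}"
proof -
  have "{1..n} = insert 1 (insert 2 {3..n})" "{2..n} = insert 2 {3..n}" using assms by auto
  then show "sum g {1..n} = g 1 + g 2 + sum g {3..n}" "sum g {2..n} = g 2 + sum g {3..n}"
    by simp_all
qed

text \<open>Each index from 2 on chooses as parent an earlier index attaining its maximum; index 2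
  can only choose 1, which accounts for the separate term \<open>Q 1 2\<close>. Consequently no
  level 1 bound lies below the diagonal sum minus the weight of a maximum spanning tree.\<close>

lemma level1_bound_eq_spanning_tree:
  assumes "2 \<le> n" "\<pi> permutes {1..n}"
    and sym: "\<And>i j. i \<in> {1..n} \<Longrightarrow> j \<in> {1..n} \<Longrightarrow> X i j = X j i"
  shows "\<exists>T. spanning_tree {1..n} T \<and> level1_bound n X \<pi> = (\<Sum>i=1..n. X i i) - sum (edge_weight X) T"
proof -
  have "\<forall>i\<in>{2..n}. \<exists>p\<in>{1..<i}. X (\<pi> p) (\<pi> i) = (MAX j\<in>{1..<i}. X (\<pi> j) (\<pi> i))"
  proof
    fix i assume i: "i \<in> {2..n}"
    have "(MAX j\<in>{1..<i}. X (\<pi> j) (\<pi> i)) \<in> (\<lambda>j. X (\<pi> j) (\<pi> i)) ` {1..<i}"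
      using i by (intro Max_in) auto
    then show "\<exists>p\<in>{1..<i}. X (\<pi> p) (\<pi> i) = (MAX j\<in>{1..<i}. X (\<pi> j) (\<pi> i))"
      by (metis (no_types, lifting) imageE)
  qed
  then obtain p where p: "\<And>i. i \<in> {2..n} \<Longrightarrow> p i \<in> {1..<i}"
    and pmax: "\<And>i. i \<in> {2..n} \<Longrightarrow> X (\<pi> (p i)) (\<pi> i) = (MAX j\<in>{1..<i}. X (\<pi> j) (\<pi> i))"
    by metis
  define e where "e i = {\<pi> i, \<pi> (p i)}" for i
  have bij: "bij_betw \<pi> {1..n} {1..n}" using assms(2) by (rule permutes_imp_bij)
  have tree: "spanning_tree {1..n} (e ` {2..n})"
    unfolding e_def using assms(1) p by (intro parent_edges_spanning_tree[OF bij]) auto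
  have inj: "inj_on e {2..n}"
    unfolding e_def by (rule parent_edges_inj[OF bij_betw_imp_inj_on[OF bij] p])
  have weight: "edge_weight X (e i) = X (\<pi> (p i)) (\<pi> i)" if i: "i \<in> {2..n}" for i
  proof -
    have "p i \<in> {1..n}" "i \<in> {1..n}" using p[OF i] i by auto
    then have "\<pi> (p i) \<in> {1..n}" "\<pi> i \<in> {1..n}" using permutes_in_image[OF assms(2)] by blast+
    then show ?thesis using edge_weight_doubleton[of X "\<pi> i" "\<pi> (p i)"] sym by (simp add: e_def)
  qed
  have "p 2 = 1" using p[of 2] assms(1) by auto
  have "sum (edge_weight X) (e ` {2..n}) = (\<Sum>i=2..n. X (\<pi> (p i)) (\<pi> i))"
    unfolding sum.reindex[OF inj] using weight by (intro sum.cong) auto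
  also have "\<dots> = X (\<pi> 1) (\<pi> 2) + (\<Sum>i=3..n. X (\<pi> (p i)) (\<pi> i))"
    using sum_split_first_two(2)[OF assms(1)] \<open>p 2 = 1\<close> by simp
  also have "(\<Sum>i=3..n. X (\<pi> (p i)) (\<pi> i)) = (\<Sum>i=3..n. MAX j\<in>{1..<i}. X (\<pi> j) (\<pi> i))"
    using pmax by (intro sum.cong) auto
  finally have T: "sum (edge_weight X) (e ` {2..n}) =
    X (\<pi> 1) (\<pi> 2) + (\<Sum>i=3..n. MAX j\<in>{1..<i}. X (\<pi> j) (\<pi> i))" .
  have D: "(\<Sum>i=1..n. X i i) = X (\<pi> 1) (\<pi> 1) + X (\<pi> 2) (\<pi> 2) + (\<Sum>i=3..n. X (\<pi> i) (\<pi> i))"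
    using sum.permute[OF assms(2), of "\<lambda>i. X i i"] sum_split_first_two(1)[OF assms(1), of "\<lambda>i. X (\<pi> i) (\<pi> i)"]
    by (simp add: comp_def)
  have "level1_bound n X \<pi> = (\<Sum>i=1..n. X i i) - sum (edge_weight X) (e ` {2..n})"
    unfolding level1_bound_def Let_def T D by (simp add: sum_subtractf)
  then show ?thesis using tree by blast
qed

text \<open>The maximum runs over pairs with \<open>j < l\<close>, but for a symmetric matrix the
  term is symmetric in \<open>j\<close> and \<open>l\<close>, so the two indices may be supplied in
  either order.\<close>

lemma level2_term_ge:
  fixes X :: "nat \<Rightarrow> nat \<Rightarrow> real"
  assumes "\<And>j l. 1 \<le> j \<Longrightarrow> j < i \<Longrightarrow> 1 \<le> l \<Longrightarrow> l < i \<Longrightarrow> X j l = X l j"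
    and "j \<in> {1..<i}" "l \<in> {1..<i}" "j \<noteq> l"
  shows "X j i + X l i - min (X j i) (min (X l i) (X j l)) \<le>
    (MAX (j, l)\<in>{(j, l). 1 \<le> j \<and> j < l \<and> l < i}. X j i + X l i - min (X j i) (min (X l i) (X j l)))"
    (is "_ \<le> Max (?g ` ?A)")
proof -
  have "?A \<subseteq> {..<i} \<times> {..<i}" by auto
  then have fin: "finite (?g ` ?A)" using finite_subset by blast
  show ?thesis
  proof (cases "j < l")
    case True
    then have "?g (j, l) \<in> ?g ` ?A" using assms(2,3) by (intro imageI) auto
    then show ?thesis using Max_ge[OF fin] by fastforce
  next
    case False
    then have "?g (l, j) \<in> ?g ` ?A" using assms(2-4) by (intro imageI) auto
    then have "?g (l, j) \<le> Max (?g ` ?A)" by (rule Max_ge[OF fin])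
    moreover have "X l j = X j l" using assms by simp
    ultimately show ?thesis by (simp add: min.left_commute add.commute)
  qed
qed

text \<open>Pairing the parent with any other earlier index, which exists from position 3 on, gives
  a term at least the parent entry, as the minimum is at most the entry of the other index. At
  \<open>i0\<close> the partner \<open>j0\<close> makes that comparison strict: the minimum is at
  most \<open>X (f j0) (f (p i0))\<close>, which is below \<open>X (f j0) (f i0)\<close>.\<close>

lemma level2_bound_less:
  assumes "bij_betw f {1..n} {1..n}" "\<And>i. i \<in> {2..n} \<Longrightarrow> p i \<in> {1..<i}"
    and sym: "\<And>i j. i \<in> {1..n} \<Longrightarrow> j \<in> {1..n} \<Longrightarrow> X i j = X j i"
    and gain: "i0 \<in> {3..n}" "j0 \<in> {1..<i0}" "j0 \<noteq> p i0" "X (f j0) (f (p i0)) < X (f j0) (f i0)"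
  shows "\<exists>\<pi>. \<pi> permutes {1..n} \<and>
    level2_bound n X \<pi> < (\<Sum>i=1..n. X i i) - (\<Sum>i=2..n. X (f i) (f (p i)))"
proof -
  define \<pi> where "\<pi> i = (if i \<in> {1..n} then f i else i)" for i
  have "bij_betw \<pi> {1..n} {1..n}"
    using assms(1) bij_betw_cong[of "{1..n}" f \<pi>] by (simp add: \<pi>_def)
  then have perm: "\<pi> permutes {1..n}" by (rule bij_imp_permutes) (auto simp: \<pi>_def)
  have n: "2 \<le> n" using gain(1) by auto
  have in_n: "\<pi> i \<in> {1..n}" if "i \<in> {1..n}" for i using permutes_in_image[OF perm] that by blast
  let ?Q = "\<lambda>i j. X (\<pi> i) (\<pi> j)"
  let ?M = "\<lambda>i. MAX (j, l)\<in>{(j, l). 1 \<le> j \<and> j < l \<and> l < i}. ?Q j i + ?Q l i - min (?Q j i) (min (?Q l i) (?Q j l))"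
  have symQ: "?Q i j = ?Q j i" if "i \<in> {1..n}" "j \<in> {1..n}" for i j using sym in_n that by blast
  have ge: "?Q j i + ?Q l i - min (?Q j i) (min (?Q l i) (?Q j l)) \<le> ?M i"
    if "i \<in> {3..n}" "j \<in> {1..<i}" "l \<in> {1..<i}" "j \<noteq> l" for i j l
    by (rule level2_term_ge[where X = ?Q]) (use that in \<open>auto intro!: symQ\<close>)
  have le: "?Q (p i) i \<le> ?M i" if i: "i \<in> {3..n}" for i
  proof -
    have pi: "p i \<in> {1..<i}" using assms(2)[of i] i by auto
    obtain l where l: "l \<in> {1..<i}" "l \<noteq> p i"
    proof (cases "p i = 1")
      case True
      then show ?thesis using that[of 2] i by auto
    next
      case False
      then show ?thesis using that[of 1] i by auto
    qed
    have "?Q (p i) i \<le> ?Q (p i) i + ?Q l i - min (?Q (p i) i) (min (?Q l i) (?Q (p i) l))"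
      by (auto simp: min_def)
    also have "\<dots> \<le> ?M i" using ge[OF i pi l(1)] l(2) by blast
    finally show ?thesis .
  qed
  have less: "?Q (p i0) i0 < ?M i0"
  proof -
    have pi: "p i0 \<in> {1..<i0}" using assms(2)[of i0] gain(1) by auto
    have "p i0 \<in> {1..n}" "j0 \<in> {1..n}" "i0 \<in> {1..n}" using pi gain(1,2) by auto
    then have "?Q j0 (p i0) < ?Q j0 i0" using gain(4) by (simp add: \<pi>_def)
    then have "?Q (p i0) i0 < ?Q j0 i0 + ?Q (p i0) i0 - min (?Q j0 i0) (min (?Q (p i0) i0) (?Q j0 (p i0)))"
      by (auto simp: min_def)
    also have "\<dots> \<le> ?M i0" using ge[OF gain(1,2) pi gain(3)] .
    finally show ?thesis .
  qed
  have "(\<Sum>i=3..n. ?Q (p i) i) < (\<Sum>i=3..n. ?M i)"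
    using le less gain(1) by (intro sum_strict_mono_ex1) auto
  moreover have "(\<Sum>i=2..n. X (f i) (f (p i))) = (\<Sum>i=2..n. ?Q (p i) i)"
  proof (intro sum.cong refl)
    fix i assume i: "i \<in> {2..n}"
    then have "i \<in> {1..n}" "p i \<in> {1..n}" using assms(2)[OF i] by auto
    then show "X (f i) (f (p i)) = ?Q (p i) i" using symQ[of i "p i"] by (simp add: \<pi>_def)
  qed
  moreover have "p 2 = 1" using assms(2)[of 2] n by auto
  then have "(\<Sum>i=2..n. ?Q (p i) i) = ?Q 1 2 + (\<Sum>i=3..n. ?Q (p i) i)"
    using sum_split_first_two(2)[OF n] by simp
  moreover have "(\<Sum>i=1..n. X i i) = ?Q 1 1 + ?Q 2 2 + (\<Sum>i=3..n. ?Q i i)"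
    using sum.permute[OF perm, of "\<lambda>i. X i i"] sum_split_first_two(1)[OF n, of "\<lambda>i. ?Q i i"]
    by (simp add: comp_def)
  moreover have "level2_bound n X \<pi> = ?Q 1 1 + ?Q 2 2 - ?Q 1 2 + ((\<Sum>i=3..n. ?Q i i) - (\<Sum>i=3..n. ?M i))"
    unfolding level2_bound_def Let_def by (simp only: sum_subtractf)
  ultimately have "level2_bound n X \<pi> < (\<Sum>i=1..n. X i i) - (\<Sum>i=2..n. X (f i) (f (p i)))" by linarith
  then show ?thesis using perm by blast
qed

text \<open>In the ordering of \<open>T'\<close> with \<open>l\<close> attached that starts with \<open>k, l\<close>, the strict gain occurs at
  the first index \<open>i\<close> whose entry \<open>X i l\<close> is maximal apart from \<open>X k l\<close>; taking the first one
  settles ties.\<close>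

lemma best_level2_less_best_level1:
  fixes X :: "nat \<Rightarrow> nat \<Rightarrow> real"
  assumes n: "3 \<le> n" and l: "l \<in> {1..n}"
    and sym: "\<And>i j. i \<in> {1..n} \<Longrightarrow> j \<in> {1..n} \<Longrightarrow> X i j = X j i"
    and T': "max_spanning_tree (edge_weight X) ({1..n} - {l}) T'"
    and light: "\<And>x. x \<in> {1..n} - {l} \<Longrightarrow> X x l \<le> m"
    and heavy: "\<And>x y. x \<in> {1..n} - {l} \<Longrightarrow> y \<in> {1..n} - {l} \<Longrightarrow> x \<noteq> y \<Longrightarrow>
       \<exists>z\<in>{1..n} - {l}. X x z > m \<and> X y z > m"
    and not_top: "\<And>a b. {a, b} \<in> T' \<Longrightarrow> \<exists>c\<in>{1..n} - {l, a, b}. X c l > X a l \<or> X c l > X b l"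
  shows "best_level2_bound n X < best_level1_bound n X"
proof -
  let ?V = "{1..n}" and ?w = "edge_weight X"
  have w: "?w {i, j} = X i j" if "i \<in> ?V" "j \<in> ?V" for i j
    using edge_weight_doubleton sym that by blast
  have argmax: "\<exists>k\<in>A. \<forall>x\<in>A. X x l \<le> X k l" if A: "finite A" "A \<noteq> {}" for A
  proof -
    have "(MAX x\<in>A. X x l) \<in> (\<lambda>x. X x l) ` A" using A by (intro Max_in) auto
    then obtain k where "k \<in> A" "X k l = (MAX x\<in>A. X x l)" by (metis imageE)
    moreover have "X x l \<le> (MAX x\<in>A. X x l)" if "x \<in> A" for x
      using A(1) that by (intro Max_ge) auto
    ultimately show ?thesis by metis
  qed
  have ne: "?V - {l} - {k} \<noteq> {}" for k
  proof
    assume "?V - {l} - {k} = {}"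
    then have "card ?V \<le> card {l, k}" by (intro card_mono) auto
    then show False using n card_insert_le_m1[of 2 "{k}" l] by simp
  qed
  then have ne1: "?V - {l} \<noteq> {}" by blast
  obtain k where k: "k \<in> ?V - {l}" "\<And>x. x \<in> ?V - {l} \<Longrightarrow> X x l \<le> X k l"
    using argmax[OF _ ne1] by (meson finite_Diff finite_atLeastAtMost)
  define S where "S = {i \<in> ?V - {l} - {k}. \<forall>j\<in>?V - {l} - {k}. X j l \<le> X i l}"
  obtain s where "s \<in> ?V - {l} - {k}" "\<forall>x\<in>?V - {l} - {k}. X x l \<le> X s l"
    using argmax[OF _ ne[of k]] by (meson finite_Diff finite_atLeastAtMost)
  then have s: "s \<in> S" "s \<in> ?V" unfolding S_def by blast+
  have treeT': "spanning_tree (?V - {l}) T'" using T' unfolding max_spanning_tree_def by blast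
  have "spanning_tree (insert l (?V - {l})) (insert {k, l} T')"
    by (rule spanning_tree_attach_leaf) (use treeT' k(1) in auto)
  moreover have "insert l (?V - {l}) = ?V" using l by blast
  ultimately have tree: "spanning_tree ?V (insert {k, l} T')" by simp
  obtain f p where f: "bij_betw f {1..card ?V} ?V" "f 1 = k" "f 2 = l"
    "\<And>i. i \<in> {2..card ?V} \<Longrightarrow> p i \<in> {1..<i}"
    "bij_betw (\<lambda>i. {f i, f (p i)}) {2..card ?V} (insert {k, l} T')"
    by (rule spanning_tree_ordering[OF finite_atLeastAtMost tree insertI1], rule that)
  have card: "card ?V = n" by simp
  note f = f[unfolded card]
  have fV: "f i \<in> ?V" if "i \<in> ?V" for i using f(1) that by (rule bij_betw_apply)

  have ex: "\<exists>i. i \<in> ?V \<and> f i \<in> S"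
    using s bij_betw_imp_surj_on[OF f(1)] by (metis imageE)
  define i0 where "i0 = (LEAST i. i \<in> ?V \<and> f i \<in> S)"
  have i0: "i0 \<in> ?V" "f i0 \<in> S"
    using LeastI_ex[OF ex] unfolding i0_def by blast+
  have before: "f i \<notin> S" if "i \<in> {1..<i0}" for i
    using not_less_Least[of i "\<lambda>i. i \<in> ?V \<and> f i \<in> S"] that i0(1) unfolding i0_def[symmetric] by auto
  have "f i0 \<noteq> k" "f i0 \<noteq> l" using i0(2) unfolding S_def by auto
  then have "i0 \<noteq> 1" "i0 \<noteq> 2" using f(2,3) by metis+
  then have i03: "i0 \<in> {3..n}" using i0(1) by auto
  then have p0: "p i0 \<in> {1..<i0}" "p i0 \<in> ?V" using f(4)[of i0] by auto
  have "{f i0, f (p i0)} \<in> insert {k, l} T'"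
    using f(5) i03 by (intro bij_betw_apply[OF f(5)]) auto
  moreover have "{f i0, f (p i0)} \<noteq> {k, l}"
    using \<open>f i0 \<noteq> k\<close> \<open>f i0 \<noteq> l\<close> by (auto simp: doubleton_eq_iff)
  ultimately have e0: "{f i0, f (p i0)} \<in> T'" by blast
  have pl: "f (p i0) \<in> ?V - {l}" using spanning_tree_edgeD(2)[OF treeT' e0] .
  have S0: "f i0 \<in> ?V - {l}" "\<And>j. j \<in> ?V - {l} - {k} \<Longrightarrow> X j l \<le> X (f i0) l"
    using i0(2) unfolding S_def by auto
  \<comment> \<open>Otherwise \<open>T'\<close> would have an edge between \<open>k\<close> and
    \<open>f i0\<close>, the holders of the two largest entries in the column of \<open>l\<close>,
    against \<open>not_top\<close>.\<close>
  have pk: "f (p i0) \<noteq> k"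
  proof
    assume "f (p i0) = k"
    then obtain c where c: "c \<in> ?V - {l, f i0, k}" "X c l > X (f i0) l \<or> X c l > X k l"
      using not_top[OF e0] by metis
    then show False using k(2)[of c] S0(2)[of c] by auto
  qed
  have "f (p i0) \<in> ?V - {l} - {k}" using pl pk by blast
  moreover have "f (p i0) \<notin> S" using before p0 by blast
  ultimately have "\<not> (\<forall>j\<in>?V - {l} - {k}. X j l \<le> X (f (p i0)) l)" unfolding S_def by blast
  then obtain j where "j \<in> ?V - {l} - {k}" "X (f (p i0)) l < X j l"
    by (meson not_le)
  then have "X (f (p i0)) l < X (f i0) l" using S0(2) by fastforce
  \<comment> \<open>The partner in the pair is \<open>l\<close>, which sits at position 2 and hence
    precedes \<open>i0\<close>.\<close>
  then have gain: "X (f 2) (f (p i0)) < X (f 2) (f i0)"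
    using sym[of l "f (p i0)"] sym[of l "f i0"] pl S0(1) l f(3) by auto
  have "p i0 \<noteq> 2" using pl f(3) by auto
  moreover have "2 \<in> {1..<i0}" using i03 by auto
  ultimately obtain \<pi> where \<pi>: "\<pi> permutes ?V"
    "level2_bound n X \<pi> < (\<Sum>i=1..n. X i i) - (\<Sum>i=2..n. X (f i) (f (p i)))"
    using level2_bound_less[OF f(1) f(4) sym i03 _ _ gain] by metis
  have "(\<Sum>i=2..n. X (f i) (f (p i))) = (\<Sum>i=2..n. ?w {f i, f (p i)})"
  proof (intro sum.cong refl)
    fix i assume i: "i \<in> {2..n}"
    then have "i \<in> ?V" "p i \<in> ?V" using f(4)[OF i] by auto
    then show "X (f i) (f (p i)) = ?w {f i, f (p i)}" using w[OF fV fV] by simp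
  qed
  also have "\<dots> = sum ?w (insert {k, l} T')" by (rule sum.reindex_bij_betw[OF f(5)])
  also have "\<dots> = X k l + sum ?w T'"
  proof -
    have "{k, l} \<notin> T'" using spanning_tree_edgeD(2)[OF treeT', of k l] by auto
    moreover have "finite T'" using spanning_tree_finite[OF treeT'] by simp
    ultimately show ?thesis using w[of k l] k(1) l by simp
  qed
  finally have weight: "(\<Sum>i=2..n. X (f i) (f (p i))) = X k l + sum ?w T'" .
  have fin: "finite {\<pi>. \<pi> permutes ?V}" by (rule finite_permutations) simp
  have "best_level2_bound n X \<le> level2_bound n X \<pi>"
    unfolding best_level2_bound_def using fin \<pi>(1) by (intro Min_le) auto
  also have "\<dots> < (\<Sum>i=1..n. X i i) - (sum ?w T' + X k l)" using \<pi>(2) weight by simp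
  also have "\<dots> \<le> best_level1_bound n X"
  proof -
    have "best_level1_bound n X \<in> level1_bound n X ` {\<pi>. \<pi> permutes ?V}"
      unfolding best_level1_bound_def using fin permutes_id[of ?V] by (intro Min_in) blast+
    then obtain \<sigma> where \<sigma>: "\<sigma> permutes ?V" "best_level1_bound n X = level1_bound n X \<sigma>" by blast
    obtain T where T: "spanning_tree ?V T" "level1_bound n X \<sigma> = (\<Sum>i=1..n. X i i) - sum ?w T"
      using level1_bound_eq_spanning_tree[where X = X, OF _ \<sigma>(1) sym] n by auto
    \<comment> \<open>Two bounds on the column of \<open>l\<close> enter: \<open>m\<close>, which
      the detours through common neighbours exceed, makes \<open>l\<close> a leaf; the maximum
      \<open>X k l\<close> bounds the weight of its only edge.\<close>
    have "sum ?w T \<le> sum ?w T' + X k l"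
    proof (rule spanning_tree_weight_le[OF _ l T(1) T'])
      show "?w {x, l} \<le> m" "?w {x, l} \<le> X k l" if "x \<in> ?V - {l}" for x
        using light[OF that] k(2)[OF that] w[of x l] that l by auto
      show "\<exists>z\<in>?V - {l}. ?w {x, z} > m \<and> ?w {y, z} > m"
        if xy: "x \<in> ?V - {l}" "y \<in> ?V - {l}" "x \<noteq> y" for x y
      proof -
        obtain z where "z \<in> ?V - {l}" "X x z > m" "X y z > m" using heavy[OF xy] by blast
        then show ?thesis using w[of x z] w[of y z] xy by (intro bexI[of _ z]) auto
      qed
    qed (use ne1 in auto)
    then show ?thesis using T(2) \<sigma>(2) by simp
  qed
  finally show ?thesis .
qed

section \<open>The law of the random matrix\<close>

definition unif :: "real measure" where
  "unif = uniform_measure lborel {0..1}"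

lemma sets_unif [simp, measurable_cong]: "sets unif = sets borel"
  by (simp add: unif_def)

lemma space_unif [simp]: "space unif = UNIV"
  by (simp add: unif_def)

lemma prob_space_unif: "prob_space unif"
  unfolding unif_def by (rule prob_space_uniform_measure) auto

interpretation unif: prob_space unif
  by (rule prob_space_unif)

lemma product_prob_space_unif: "product_prob_space (\<lambda>_. unif)"
  by unfold_locales

lemma product_sigma_finite_unif: "product_sigma_finite (\<lambda>_. unif)"
  by unfold_locales

lemma prob_space_unif_PiM: "prob_space (\<Pi>\<^sub>M i\<in>I. unif)"
  by (intro prob_space_PiM prob_space_unif)

lemma emeasure_unif: "B \<in> sets borel \<Longrightarrow> emeasure unif B = emeasure lborel ({0..1} \<inter> B)"
  by (simp add: unif_def divide_ennreal_def)

lemma measure_unif_atMost: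
  assumes "0 \<le> t" "t \<le> 1"
  shows "measure unif {..t} = t"
proof -
  have "{0..1} \<inter> {..t} = {0..t}" using assms by auto
  then show ?thesis using assms by (simp add: measure_def emeasure_unif)
qed

lemma measure_unif_greaterThan:
  assumes "0 \<le> t" "t \<le> 1"
  shows "measure unif {t<..} = 1 - t"
proof -
  have "{t<..} = space unif - {..t}" by auto
  then show ?thesis using unif.prob_compl[of "{..t}"] measure_unif_atMost[OF assms] by simp
qed

lemma AE_unif: "AE v in unif. 0 < v \<and> v \<le> 1"
proof -
  have "AE v in lborel. v \<in> {0..1} \<longrightarrow> 0 < v \<and> v \<le> (1::real)"
    using AE_lborel_singleton[of 0] by eventually_elim auto
  then show ?thesis unfolding unif_def by (rule AE_uniform_measureI[rotated]) simp
qed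

text \<open>For \<open>m > 0\<close> this is the mass of \<open>B\<close> under the uniform distribution on \<open>[0, m]\<close>;
  unlike \<open>uniform_measure\<close> it is visibly measurable in \<open>m\<close>.\<close>

definition scaled_unif :: "real set \<Rightarrow> real \<Rightarrow> real" where
  "scaled_unif B m = measure unif {v. m * v \<in> B}"

lemma measurable_scaled_unif [measurable]:
  assumes [measurable]: "B \<in> sets borel"
  shows "scaled_unif B \<in> borel_measurable borel"
proof -
  have "{p \<in> space (borel \<Otimes>\<^sub>M unif). fst p * snd p \<in> B} \<in> sets (borel \<Otimes>\<^sub>M unif)"
    by measurable
  then have "(\<lambda>m. emeasure unif (Pair m -` {p \<in> space (borel \<Otimes>\<^sub>M unif). fst p * snd p \<in> B})) \<in> borel_measurable borel"
    by (rule unif.measurable_emeasure_Pair)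
  moreover have "Pair m -` {p \<in> space (borel \<Otimes>\<^sub>M unif). fst p * snd p \<in> B} = {v. m * v \<in> B}" for m
    by (auto simp: space_pair_measure)
  ultimately show ?thesis unfolding scaled_unif_def measure_def by simp
qed

text \<open>Multiplication by \<open>m\<close> carries Lebesgue measure to \<open>1 / m\<close>
  times itself, which is the normalisation of the uniform law on \<open>[0, m]\<close>. This allows
  a conditionally uniform entry to be modelled as \<open>m\<close> times an independent uniform
  variable.\<close>

lemma scaled_unif_eq_uniform_measure:
  assumes "0 < m" and [measurable]: "B \<in> sets borel"
  shows "measure (uniform_measure lborel {0..m}) B = scaled_unif B m"
proof -
  have "emeasure unif {v. m * v \<in> B} = emeasure lborel ({0..1} \<inter> {v. m * v \<in> B})"
    by (rule emeasure_unif) measurable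
  also have "{0..1} \<inter> {v. m * v \<in> B} = (*) m -` ({0..m} \<inter> B) \<inter> space lborel"
    using assms(1) by (auto simp: zero_le_mult_iff mult_le_cancel_left1)
  also have "emeasure lborel \<dots> = emeasure (distr lborel borel ((*) m)) ({0..m} \<inter> B)"
    by (subst emeasure_distr) auto
  also have "\<dots> = (\<integral>\<^sup>+x. ennreal (inverse m) * indicator ({0..m} \<inter> B) x \<partial>lborel)"
    unfolding lborel_distr_mult[OF less_imp_neq[OF assms(1), symmetric]]
    using assms(1) by (subst emeasure_density) auto
  also have "\<dots> = ennreal (inverse m) * emeasure lborel ({0..m} \<inter> B)"
    by (subst nn_integral_cmult_indicator) auto
  finally have "measure unif {v. m * v \<in> B} = inverse m * measure lborel ({0..m} \<inter> B)"
    using assms(1) by (simp add: measure_def enn2real_mult)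
  moreover have "measure (uniform_measure lborel {0..m}) B = measure lborel ({0..m} \<inter> B) / m"
    using assms(1) by (subst measure_uniform_measure) auto
  ultimately show ?thesis by (simp add: scaled_unif_def field_simps)
qed

definition off_diag :: "nat \<Rightarrow> (nat \<times> nat) set" where
  "off_diag n = {(i, j). 1 \<le> i \<and> i < j \<and> j \<le> n}"

definition upper_tri :: "nat \<Rightarrow> (nat \<times> nat) set" where
  "upper_tri n = {(i, j). 1 \<le> i \<and> i \<le> j \<and> j \<le> n}"

lemma finite_upper_tri [simp]: "finite (upper_tri n)"
  by (rule finite_subset[of _ "{1..n} \<times> {1..n}"]) (auto simp: upper_tri_def)

lemma finite_off_diag [simp]: "finite (off_diag n)"
  by (rule finite_subset[of _ "{1..n} \<times> {1..n}"]) (auto simp: off_diag_def)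

lemma ball_upper_tri:
  "(\<forall>k\<in>upper_tri n. R k) \<longleftrightarrow> (\<forall>i\<in>{1..n}. R (i, i)) \<and> (\<forall>k\<in>off_diag n. R k)"
  by (fastforce simp: upper_tri_def off_diag_def le_less)

text \<open>The explicit model: with all coordinates of \<open>d\<close> and \<open>v\<close>
  independent and uniform, it has the law of the given matrix. The factor of an unordered pair is
  stored once, above the diagonal.\<close>

definition scaled_matrix :: "(nat \<Rightarrow> real) \<Rightarrow> (nat \<times> nat \<Rightarrow> real) \<Rightarrow> nat \<Rightarrow> nat \<Rightarrow> real" where
  "scaled_matrix d v i j = (if i = j then d i else min (d i) (d j) * v (min i j, max i j))"

abbreviation diag_measure :: "nat \<Rightarrow> (nat \<Rightarrow> real) measure" where
  "diag_measure n \<equiv> \<Pi>\<^sub>M i\<in>{1..n}. unif"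

abbreviation off_measure :: "nat \<Rightarrow> (nat \<times> nat \<Rightarrow> real) measure" where
  "off_measure n \<equiv> \<Pi>\<^sub>M k\<in>off_diag n. unif"

text \<open>The conditional probability, given the diagonal \<open>d\<close>, that every entry on or
  above the diagonal lies in its side of the rectangle \<open>A\<close>.\<close>

definition rect_density :: "nat \<Rightarrow> (nat \<times> nat \<Rightarrow> real set) \<Rightarrow> (nat \<Rightarrow> real) \<Rightarrow> real" where
  "rect_density n A d = (if \<forall>i\<in>{1..n}. d i \<in> A (i, i) then 1 else 0) *
     (\<Prod>k\<in>off_diag n. scaled_unif (A k) (min (d (fst k)) (d (snd k))))"

lemma measurable_rect_density [measurable]:
  assumes "\<And>k. k \<in> upper_tri n \<Longrightarrow> A k \<in> sets borel"
  shows "rect_density n A \<in> borel_measurable (diag_measure n)"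
proof -
  have [measurable]: "A (i, i) \<in> sets borel" if "i \<in> {1..n}" for i
    using assms that by (auto simp: upper_tri_def)
  have "(\<lambda>d. scaled_unif (A k) (min (d (fst k)) (d (snd k)))) \<in> borel_measurable (diag_measure n)"
    if k: "k \<in> off_diag n" for k
  proof -
    have [measurable]: "A k \<in> sets borel" "fst k \<in> {1..n}" "snd k \<in> {1..n}"
      using assms k by (auto simp: upper_tri_def off_diag_def)
    show ?thesis by measurable
  qed
  then show ?thesis unfolding rect_density_def by measurable
qed

lemma rect_density_bounds: "0 \<le> rect_density n A d" "rect_density n A d \<le> 1"
  unfolding rect_density_def
  by (auto intro!: prod_nonneg prod_le_1 simp: scaled_unif_def)

text \<open>Fubini: for fixed \<open>d\<close> the conditions above the diagonal concern distinct
  independent coordinates. The given matrix is later shown to have the same rectangle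
  probabilities.\<close>

lemma emeasure_scaled_matrix_rect:
  assumes A: "\<And>k. k \<in> upper_tri n \<Longrightarrow> A k \<in> sets borel"
  shows "emeasure (diag_measure n \<Otimes>\<^sub>M off_measure n)
      {x \<in> space (diag_measure n \<Otimes>\<^sub>M off_measure n).
        \<forall>k\<in>upper_tri n. scaled_matrix (fst x) (snd x) (fst k) (snd k) \<in> A k} =
    (\<integral>\<^sup>+d. ennreal (rect_density n A d) \<partial>diag_measure n)" (is "emeasure ?\<Omega> ?S = _")
proof -
  have [measurable]: "A (i, i) \<in> sets borel" if "i \<in> {1..n}" for i
    using A that by (auto simp: upper_tri_def)
  have S: "?S = {x \<in> space ?\<Omega>. (\<forall>i\<in>{1..n}. fst x i \<in> A (i, i)) \<and>
      (\<forall>k\<in>off_diag n. min (fst x (fst k)) (fst x (snd k)) * snd x k \<in> A k)}"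
    unfolding ball_upper_tri by (auto simp: scaled_matrix_def off_diag_def min_def max_def)
  have [measurable]: "?S \<in> sets ?\<Omega>"
  proof -
    have "{x \<in> space ?\<Omega>. min (fst x (fst k)) (fst x (snd k)) * snd x k \<in> A k} \<in> sets ?\<Omega>"
      if k: "k \<in> off_diag n" for k
    proof -
      have [measurable]: "A k \<in> sets borel" "fst k \<in> {1..n}" "snd k \<in> {1..n}" "k \<in> off_diag n"
        using A k by (auto simp: upper_tri_def off_diag_def)
      show ?thesis by measurable
    qed
    then have "{x \<in> space ?\<Omega>. \<forall>k\<in>off_diag n. min (fst x (fst k)) (fst x (snd k)) * snd x k \<in> A k} \<in> sets ?\<Omega>"
      by (intro sets.sets_Collect_finite_All) auto
    then show ?thesis unfolding S by (intro sets.sets_Collect_conj) auto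
  qed
  have "sigma_finite_measure (off_measure n)"
    using prob_space_unif_PiM by (rule prob_space_imp_sigma_finite)
  then have "emeasure ?\<Omega> ?S = (\<integral>\<^sup>+d. emeasure (off_measure n) (Pair d -` ?S) \<partial>diag_measure n)"
    by (rule sigma_finite_measure.emeasure_pair_measure_alt) measurable
  also have "\<dots> = (\<integral>\<^sup>+d. ennreal (rect_density n A d) \<partial>diag_measure n)"
  proof (rule nn_integral_cong)
    fix d assume d: "d \<in> space (diag_measure n)"
    show "emeasure (off_measure n) (Pair d -` ?S) = ennreal (rect_density n A d)"
    proof (cases "\<forall>i\<in>{1..n}. d i \<in> A (i, i)")
      case True
      let ?B = "\<lambda>k. {v. min (d (fst k)) (d (snd k)) * v \<in> A k}"
      have B: "?B k \<in> sets unif" if k: "k \<in> off_diag n" for k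
      proof -
        have [measurable]: "A k \<in> sets borel" using A k by (auto simp: upper_tri_def off_diag_def)
        have "{v \<in> space unif. min (d (fst k)) (d (snd k)) * v \<in> A k} \<in> sets unif" by measurable
        then show ?thesis by simp
      qed
      have "Pair d -` ?S = {v \<in> space (off_measure n). \<forall>k\<in>off_diag n. v k \<in> ?B k}"
        unfolding S using True d by (auto simp: space_pair_measure)
      also have "emeasure (off_measure n) \<dots> = (\<Prod>k\<in>off_diag n. emeasure unif (?B k))"
        by (rule product_prob_space.emeasure_PiM_Collect[OF product_prob_space_unif]) (use B in auto)
      also have "\<dots> = ennreal (\<Prod>k\<in>off_diag n. measure unif (?B k))"
        by (simp add: unif.emeasure_eq_measure prod_ennreal)
      finally show ?thesis using True by (simp add: rect_density_def scaled_unif_def)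
    next
      case False
      then have "Pair d -` ?S = {}" unfolding S by auto
      moreover have "rect_density n A d = 0" using False unfolding rect_density_def by (simp only: if_False mult_zero_left)
      ultimately show ?thesis by (simp only: emeasure_empty ennreal_0)
    qed
  qed
  finally show ?thesis .
qed

lemma measurable_scaled_matrix_upper_tri:
  "(\<lambda>x. \<lambda>k\<in>upper_tri n. scaled_matrix (fst x) (snd x) (fst k) (snd k)) \<in>
    measurable (diag_measure n \<Otimes>\<^sub>M off_measure n) (\<Pi>\<^sub>M k\<in>upper_tri n. borel)"
  (is "_ \<in> measurable ?\<Omega> _")
proof (intro measurable_restrict)
  fix k assume k: "k \<in> upper_tri n"
  then have [measurable]: "fst k \<in> {1..n}" "snd k \<in> {1..n}" by (auto simp: upper_tri_def)
  show "(\<lambda>x. scaled_matrix (fst x) (snd x) (fst k) (snd k)) \<in> borel_measurable ?\<Omega>"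
  proof (cases "fst k = snd k")
    case True
    have "(\<lambda>x. fst x (snd k)) \<in> borel_measurable ?\<Omega>" by measurable
    then show ?thesis by (simp only: scaled_matrix_def True if_True refl)
  next
    case False
    then have [measurable]: "k \<in> off_diag n"
      using k by (auto simp: upper_tri_def off_diag_def)
    have "scaled_matrix d v (fst k) (snd k) = min (d (fst k)) (d (snd k)) * v k" for d v
      using False k by (auto simp: scaled_matrix_def upper_tri_def min_def max_def)
    moreover have "(\<lambda>x. min (fst x (fst k)) (fst x (snd k)) * snd x k) \<in> borel_measurable ?\<Omega>"
      by measurable
    ultimately show ?thesis by (simp only:)
  qed
qed

section \<open>Dependence of the best bounds on the entries: congruence and measurability\<close>

lemma best_level1_bound_cong:
  assumes "2 \<le> n" and XY: "\<And>i j. i \<in> {1..n} \<Longrightarrow> j \<in> {1..n} \<Longrightarrow> X i j = Y i j"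
  shows "best_level1_bound n X = best_level1_bound n Y"
  unfolding best_level1_bound_def
proof (intro arg_cong[of _ _ Min] image_cong refl)
  fix \<pi> assume "\<pi> \<in> {\<pi>. \<pi> permutes {1..n}}"
  then have "\<pi> i \<in> {1..n} \<longleftrightarrow> i \<in> {1..n}" for i by (rule CollectE) (rule permutes_in_image)
  then have Q: "X (\<pi> i) (\<pi> j) = Y (\<pi> i) (\<pi> j)" if "i \<in> {1..n}" "j \<in> {1..n}" for i j using XY that by blast
  have "(MAX j\<in>{1..<i}. X (\<pi> j) (\<pi> i)) = (MAX j\<in>{1..<i}. Y (\<pi> j) (\<pi> i))" if "i \<in> {3..n}" for i
    using that by (intro arg_cong[of _ _ Max] image_cong refl Q) auto
  then show "level1_bound n X \<pi> = level1_bound n Y \<pi>"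
    unfolding level1_bound_def Let_def using Q assms(1)
    by (intro arg_cong2[of _ _ _ _ "(+)"] arg_cong2[of _ _ _ _ "(-)"] sum.cong refl) auto
qed

lemma best_level2_bound_cong:
  assumes "2 \<le> n" and XY: "\<And>i j. i \<in> {1..n} \<Longrightarrow> j \<in> {1..n} \<Longrightarrow> X i j = Y i j"
  shows "best_level2_bound n X = best_level2_bound n Y"
  unfolding best_level2_bound_def
proof (intro arg_cong[of _ _ Min] image_cong refl)
  fix \<pi> assume "\<pi> \<in> {\<pi>. \<pi> permutes {1..n}}"
  then have "\<pi> i \<in> {1..n} \<longleftrightarrow> i \<in> {1..n}" for i by (rule CollectE) (rule permutes_in_image)
  then have Q: "X (\<pi> i) (\<pi> j) = Y (\<pi> i) (\<pi> j)" if "i \<in> {1..n}" "j \<in> {1..n}" for i j using XY that by blast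
  let ?t = "\<lambda>X i (j, l). X (\<pi> j) (\<pi> i) + X (\<pi> l) (\<pi> i) - min (X (\<pi> j) (\<pi> i)) (min (X (\<pi> l) (\<pi> i)) (X (\<pi> j) (\<pi> l)))"
  have "Max (?t X i ` {(j, l). 1 \<le> j \<and> j < l \<and> l < i}) = Max (?t Y i ` {(j, l). 1 \<le> j \<and> j < l \<and> l < i})"
    if i: "i \<in> {3..n}" for i
  proof (intro arg_cong[of _ _ Max] image_cong refl)
    fix p assume p: "p \<in> {(j, l). 1 \<le> j \<and> j < l \<and> l < i}"
    have "fst p \<in> {1..n}" "snd p \<in> {1..n}" "i \<in> {1..n}" using p i by auto
    then show "?t X i p = ?t Y i p" by (simp add: Q split_beta)
  qed
  then show "level2_bound n X \<pi> = level2_bound n Y \<pi>"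
    unfolding level2_bound_def Let_def using Q assms(1)
    by (intro arg_cong2[of _ _ _ _ "(+)"] arg_cong2[of _ _ _ _ "(-)"] sum.cong refl) auto
qed

lemma measurable_best_level1_bound:
  fixes f :: "'a \<Rightarrow> nat \<Rightarrow> nat \<Rightarrow> real"
  assumes "2 \<le> n" and f: "\<And>i j. i \<in> {1..n} \<Longrightarrow> j \<in> {1..n} \<Longrightarrow> (\<lambda>x. f x i j) \<in> borel_measurable N"
  shows "(\<lambda>x. best_level1_bound n (f x)) \<in> borel_measurable N"
  unfolding best_level1_bound_def
proof (intro borel_measurable_Min finite_permutations)
  fix \<pi> assume "\<pi> \<in> {\<pi>. \<pi> permutes {1..n}}"
  then have "\<pi> i \<in> {1..n} \<longleftrightarrow> i \<in> {1..n}" for i by (rule CollectE) (rule permutes_in_image)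
  then have Q: "(\<lambda>x. f x (\<pi> i) (\<pi> j)) \<in> borel_measurable N" if "i \<in> {1..n}" "j \<in> {1..n}" for i j
    using f that by blast
  show "(\<lambda>x. level1_bound n (f x) \<pi>) \<in> borel_measurable N"
    unfolding level1_bound_def Let_def
    by (intro borel_measurable_add borel_measurable_diff borel_measurable_sum borel_measurable_Max Q)
      (use assms(1) in auto)
qed simp

lemma measurable_best_level2_bound:
  fixes f :: "'a \<Rightarrow> nat \<Rightarrow> nat \<Rightarrow> real"
  assumes "2 \<le> n" and f: "\<And>i j. i \<in> {1..n} \<Longrightarrow> j \<in> {1..n} \<Longrightarrow> (\<lambda>x. f x i j) \<in> borel_measurable N"
  shows "(\<lambda>x. best_level2_bound n (f x)) \<in> borel_measurable N"
  unfolding best_level2_bound_def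
proof (intro borel_measurable_Min finite_permutations)
  fix \<pi> assume "\<pi> \<in> {\<pi>. \<pi> permutes {1..n}}"
  then have "\<pi> i \<in> {1..n} \<longleftrightarrow> i \<in> {1..n}" for i by (rule CollectE) (rule permutes_in_image)
  then have Q: "(\<lambda>x. f x (\<pi> i) (\<pi> j)) \<in> borel_measurable N" if "i \<in> {1..n}" "j \<in> {1..n}" for i j
    using f that by blast
  let ?A = "\<lambda>i. {(j, l). 1 \<le> j \<and> j < l \<and> l < i}"
  have "(\<lambda>x. MAX (j, l)\<in>?A i. f x (\<pi> j) (\<pi> i) + f x (\<pi> l) (\<pi> i)
      - min (f x (\<pi> j) (\<pi> i)) (min (f x (\<pi> l) (\<pi> i)) (f x (\<pi> j) (\<pi> l)))) \<in> borel_measurable N"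
    if i: "i \<in> {3..n}" for i
  proof (rule borel_measurable_Max)
    have "?A i \<subseteq> {..<i} \<times> {..<i}" by auto
    then show "finite (?A i)" by (rule finite_subset) simp
    fix p assume p: "p \<in> ?A i"
    have "fst p \<in> {1..n}" "snd p \<in> {1..n}" "i \<in> {1..n}" using p i by auto
    then show "(\<lambda>x. case p of (j, l) \<Rightarrow> f x (\<pi> j) (\<pi> i) + f x (\<pi> l) (\<pi> i)
      - min (f x (\<pi> j) (\<pi> i)) (min (f x (\<pi> l) (\<pi> i)) (f x (\<pi> j) (\<pi> l)))) \<in> borel_measurable N"
      unfolding split_beta by (intro borel_measurable_add borel_measurable_diff borel_measurable_min Q)
  qed
  then show "(\<lambda>x. level2_bound n (f x) \<pi>) \<in> borel_measurable N"
    unfolding level2_bound_def Let_def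
    by (intro borel_measurable_add borel_measurable_diff borel_measurable_sum Q)
      (use assms(1) in auto)
qed simp

section \<open>Identification of the given matrix with the explicit model\<close>

context random_matrix
begin

lemma measurable_matrix_upper_tri:
  "(\<lambda>\<omega>. \<lambda>k\<in>upper_tri n. P (fst k) (snd k) \<omega>) \<in> measurable M (\<Pi>\<^sub>M k\<in>upper_tri n. borel)"
  using random_variables by (intro measurable_restrict) (auto simp: upper_tri_def)

abbreviation diag_alg :: "'a measure" where
  "diag_alg \<equiv> diagonal_algebra M n P"

definition diag :: "'a \<Rightarrow> nat \<Rightarrow> real" where
  "diag \<omega> = (\<lambda>i\<in>{1..n}. P i i \<omega>)"

lemma measurable_diag: "diag \<in> measurable M (\<Pi>\<^sub>M i\<in>{1..n}. borel)"
  unfolding diag_def using random_variables by (intro measurable_restrict) auto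

lemma sets_diag_alg: "A \<in> sets (\<Pi>\<^sub>M i\<in>{1..n}. borel) \<Longrightarrow> diag -` A \<inter> space M \<in> sets diag_alg"
  unfolding diagonal_algebra_def diag_def[symmetric, abs_def] by (rule in_vimage_algebra)

lemma subalgebra_diag_alg: "subalgebra M diag_alg"
  unfolding subalgebra_def
proof
  show "space diag_alg = space M" by (simp add: diagonal_algebra_def)
  have "diag \<in> space M \<rightarrow> space (\<Pi>\<^sub>M i\<in>{1..n}. (borel :: real measure))"
    by (auto simp: diag_def space_PiM)
  then show "sets diag_alg \<subseteq> sets M"
    unfolding diagonal_algebra_def diag_def[symmetric, abs_def]
    using measurable_sets[OF measurable_diag] by (subst sets_vimage_algebra2) auto
qed

sublocale diag: finite_measure_subalgebra M diag_alg
  by unfold_locales (rule subalgebra_diag_alg)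

lemma distr_diag:
  assumes "1 \<le> n"
  shows "distr M (\<Pi>\<^sub>M i\<in>{1..n}. borel) diag = diag_measure n"
proof -
  have "distr M (\<Pi>\<^sub>M i\<in>{1..n}. borel) diag = (\<Pi>\<^sub>M i\<in>{1..n}. distr M borel (P i i))"
    unfolding diag_def
    using indep_vars_iff_distr_eq_PiM'[of "{1..n}" "\<lambda>i. P i i" "\<lambda>_. borel"] diagonal_indep random_variables assms
    by auto
  also have "\<dots> = diag_measure n"
  proof (intro PiM_cong refl)
    fix i assume i: "i \<in> {1..n}"
    have "distr M borel (P i i) = distr M lborel (P i i)" by (rule distr_cong) auto
    then show "distr M borel (P i i) = unif" using diagonal_uniform[OF i] by (simp add: unif_def)
  qed
  finally show ?thesis .
qed

lemma AE_diag_pos: "AE \<omega> in M. \<forall>i\<in>{1..n}. 0 < P i i \<omega>"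
proof (intro AE_finite_allI)
  fix i assume i: "i \<in> {1..n}"
  have "AE v in distr M lborel (P i i). 0 < v"
    unfolding diagonal_uniform[OF i] unif_def[symmetric] using AE_unif by auto
  moreover have "P i i \<in> measurable M lborel" using random_variables[OF i i] by simp
  ultimately show "AE \<omega> in M. 0 < P i i \<omega>"
    by (subst (asm) AE_distr_iff) auto
qed simp

text \<open>Conditional independence is applied to all off-diagonal indices at once. The diagonal is
  almost surely positive, which excludes degenerate intervals and permits the passage from
  \<open>uniform_measure\<close> to \<open>scaled_unif\<close>.\<close>

lemma cond_prob_off_diag:
  assumes A: "\<And>k. k \<in> off_diag n \<Longrightarrow> A k \<in> sets borel"
  shows "AE \<omega> in M. real_cond_exp M diag_alg
      (indicator {\<omega> \<in> space M. \<forall>k\<in>off_diag n. P (fst k) (snd k) \<omega> \<in> A k}) \<omega> =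
    (\<Prod>k\<in>off_diag n. scaled_unif (A k) (min (P (fst k) (fst k) \<omega>) (P (snd k) (snd k) \<omega>)))"
proof -
  have "\<forall>J B. finite J \<longrightarrow> J \<subseteq> off_diag n \<longrightarrow> (\<forall>k\<in>J. B k \<in> sets borel) \<longrightarrow>
        (AE \<omega> in M.
           cond_prob_given M diag_alg {\<omega>\<in>space M. \<forall>k\<in>J. P (fst k) (snd k) \<omega> \<in> B k} \<omega> =
           (\<Prod>k\<in>J. cond_prob_given M diag_alg {\<omega>\<in>space M. P (fst k) (snd k) \<omega> \<in> B k} \<omega>))"
    using off_diagonal_cond_indep unfolding cond_indep_vars_def off_diag_def by (simp only: case_prod_beta)
  then have 1: "AE \<omega> in M.
           cond_prob_given M diag_alg {\<omega>\<in>space M. \<forall>k\<in>off_diag n. P (fst k) (snd k) \<omega> \<in> A k} \<omega> =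
           (\<Prod>k\<in>off_diag n. cond_prob_given M diag_alg {\<omega>\<in>space M. P (fst k) (snd k) \<omega> \<in> A k} \<omega>)"
    using A by simp
  have "AE \<omega> in M. \<forall>k\<in>off_diag n. cond_prob_given M diag_alg {\<omega>\<in>space M. P (fst k) (snd k) \<omega> \<in> A k} \<omega> =
      measure (uniform_measure lborel {0..min (P (fst k) (fst k) \<omega>) (P (snd k) (snd k) \<omega>)}) (A k)"
  proof (intro AE_finite_allI)
    fix k assume k: "k \<in> off_diag n"
    then have "1 \<le> fst k" "fst k < snd k" "snd k \<le> n" by (auto simp: off_diag_def)
    from off_diagonal_cond_law[OF this]
    show "AE \<omega> in M. cond_prob_given M diag_alg {\<omega>\<in>space M. P (fst k) (snd k) \<omega> \<in> A k} \<omega> =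
      measure (uniform_measure lborel {0..min (P (fst k) (fst k) \<omega>) (P (snd k) (snd k) \<omega>)}) (A k)"
      unfolding has_cond_law_def using A[OF k] by blast
  qed simp
  with 1 AE_diag_pos show ?thesis
  proof eventually_elim
    case (elim \<omega>)
    have "measure (uniform_measure lborel {0..min (P (fst k) (fst k) \<omega>) (P (snd k) (snd k) \<omega>)}) (A k) =
       scaled_unif (A k) (min (P (fst k) (fst k) \<omega>) (P (snd k) (snd k) \<omega>))" if k: "k \<in> off_diag n" for k
      using elim(2) k A[OF k] by (intro scaled_unif_eq_uniform_measure) (auto simp: off_diag_def)
    then show ?case using elim(1,3) by (simp add: cond_prob_given_def)
  qed
qed

text \<open>The event is the intersection of \<open>S\<close>, which depends on the diagonal only,
  and \<open>T\<close>, which concerns the other entries. As \<open>S\<close> belongs to the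
  diagonal algebra, the indicator of \<open>T\<close> may be replaced by its conditional expectation
  when integrating over \<open>S\<close>; what remains is a function of the diagonal, whose law is
  known.\<close>

lemma emeasure_matrix_rect:
  assumes n: "1 \<le> n" and A: "\<And>k. k \<in> upper_tri n \<Longrightarrow> A k \<in> sets borel"
  shows "emeasure M {\<omega> \<in> space M. \<forall>k\<in>upper_tri n. P (fst k) (snd k) \<omega> \<in> A k} =
    (\<integral>\<^sup>+d. ennreal (rect_density n A d) \<partial>diag_measure n)"
proof -
  define D where "D = {d \<in> space (\<Pi>\<^sub>M i\<in>{1..n}. borel). \<forall>i\<in>{1..n}. d i \<in> A (i, i)}"
  define T where "T = {\<omega> \<in> space M. \<forall>k\<in>off_diag n. P (fst k) (snd k) \<omega> \<in> A k}"
  define S where "S = diag -` D \<inter> space M"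
  have off: "A k \<in> sets borel" if "k \<in> off_diag n" for k
    using A that by (auto simp: upper_tri_def off_diag_def)
  have "D \<in> sets (\<Pi>\<^sub>M i\<in>{1..n}. borel)"
    unfolding D_def
  proof (intro sets.sets_Collect_finite_All)
    fix i assume i: "i \<in> {1..n}"
    then have [measurable]: "A (i, i) \<in> sets borel" using A by (auto simp: upper_tri_def)
    show "{d \<in> space (\<Pi>\<^sub>M i\<in>{1..n}. borel). d i \<in> A (i, i)} \<in> sets (\<Pi>\<^sub>M i\<in>{1..n}. borel)"
      using i by measurable
  qed simp
  then have S: "S \<in> sets diag_alg" unfolding S_def by (rule sets_diag_alg)
  then have SM: "S \<in> sets M" using subalgebra_diag_alg by (auto simp: subalgebra_def)
  have TM: "T \<in> sets M"
    unfolding T_def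
  proof (intro sets.sets_Collect_finite_All)
    fix k assume k: "k \<in> off_diag n"
    then have [measurable]: "A k \<in> sets borel" "P (fst k) (snd k) \<in> borel_measurable M"
      using off random_variables by (auto simp: off_diag_def)
    show "{\<omega> \<in> space M. P (fst k) (snd k) \<omega> \<in> A k} \<in> sets M" by measurable
  qed simp
  have "space (\<Pi>\<^sub>M i\<in>{1..n}. (borel :: real measure)) = {1..n} \<rightarrow>\<^sub>E UNIV" by (simp add: space_PiM)
  then have S_iff: "\<omega> \<in> S \<longleftrightarrow> \<omega> \<in> space M \<and> (\<forall>i\<in>{1..n}. P i i \<omega> \<in> A (i, i))" for \<omega>
    unfolding S_def D_def by (auto simp: diag_def)
  have dens: "rect_density n A (diag \<omega>) = indicator S \<omega> *
      (\<Prod>k\<in>off_diag n. scaled_unif (A k) (min (P (fst k) (fst k) \<omega>) (P (snd k) (snd k) \<omega>)))"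
    if "\<omega> \<in> space M" for \<omega>
  proof -
    have "(\<Prod>k\<in>off_diag n. scaled_unif (A k) (min (diag \<omega> (fst k)) (diag \<omega> (snd k)))) =
      (\<Prod>k\<in>off_diag n. scaled_unif (A k) (min (P (fst k) (fst k) \<omega>) (P (snd k) (snd k) \<omega>)))"
      by (intro prod.cong) (auto simp: diag_def off_diag_def)
    moreover have "(if \<forall>i\<in>{1..n}. diag \<omega> i \<in> A (i, i) then 1 else 0) = (indicator S \<omega> :: real)"
      using that by (auto simp: S_iff diag_def indicator_def)
    ultimately show ?thesis unfolding rect_density_def by simp
  qed
  have "{\<omega> \<in> space M. \<forall>k\<in>upper_tri n. P (fst k) (snd k) \<omega> \<in> A k} = S \<inter> T"
    unfolding ball_upper_tri by (auto simp: S_iff T_def)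
  then have "emeasure M {\<omega> \<in> space M. \<forall>k\<in>upper_tri n. P (fst k) (snd k) \<omega> \<in> A k} = ennreal (measure M (S \<inter> T))"
    by (simp add: emeasure_eq_measure)
  also have "measure M (S \<inter> T) = (\<integral>\<omega>\<in>S. indicator T \<omega> \<partial>M)"
    using SM TM by (simp add: set_lebesgue_integral_def indicator_inter_arith[symmetric])
  also have "\<dots> = (\<integral>\<omega>\<in>S. real_cond_exp M diag_alg (indicator T) \<omega> \<partial>M)"
    using S TM by (intro diag.real_cond_exp_intA) (auto simp: emeasure_eq_measure)
  also have "\<dots> = (\<integral>\<omega>. rect_density n A (diag \<omega>) \<partial>M)"
    unfolding set_lebesgue_integral_def
  proof (rule integral_cong_AE)
    have "real_cond_exp M diag_alg (indicator T) \<in> borel_measurable M" by simp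
    then show "(\<lambda>\<omega>. indicator S \<omega> *\<^sub>R real_cond_exp M diag_alg (indicator T) \<omega>) \<in> borel_measurable M"
      using SM by measurable
    have "diag \<in> measurable M (diag_measure n)"
      using measurable_diag by (simp cong: measurable_cong_sets sets_PiM_cong)
    from measurable_compose[OF this measurable_rect_density[OF A]]
    show "(\<lambda>\<omega>. rect_density n A (diag \<omega>)) \<in> borel_measurable M" .
    have "AE \<omega> in M. real_cond_exp M diag_alg (indicator T) \<omega> =
        (\<Prod>k\<in>off_diag n. scaled_unif (A k) (min (P (fst k) (fst k) \<omega>) (P (snd k) (snd k) \<omega>)))"
      unfolding T_def by (rule cond_prob_off_diag) (rule off)
    then show "AE \<omega> in M. indicator S \<omega> *\<^sub>R real_cond_exp M diag_alg (indicator T) \<omega> = rect_density n A (diag \<omega>)"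
      using AE_space by eventually_elim (simp add: dens)
  qed
  also have "\<dots> = (\<integral>d. rect_density n A d \<partial>distr M (\<Pi>\<^sub>M i\<in>{1..n}. borel) diag)"
    using measurable_rect_density[OF A]
    by (subst integral_distr[OF measurable_diag]) (auto cong: measurable_cong_sets sets_PiM_cong)
  also have "\<dots> = (\<integral>d. rect_density n A d \<partial>diag_measure n)" unfolding distr_diag[OF n] ..
  also have "ennreal \<dots> = (\<integral>\<^sup>+d. ennreal (rect_density n A d) \<partial>diag_measure n)"
  proof (rule nn_integral_eq_integral[symmetric])
    show "integrable (diag_measure n) (rect_density n A)"
      using rect_density_bounds measurable_rect_density[OF A]
      by (intro finite_measure.integrable_const_bound[where B = 1]
          prob_space.finite_measure prob_space_unif_PiM) (auto simp: abs_of_nonneg)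
  qed (auto simp: rect_density_bounds)
  finally show ?thesis .
qed

text \<open>Rectangles are stable under intersection and generate the product algebra, so agreement
  on them, shown on both sides by the same integral, determines the law.\<close>

lemma distr_matrix:
  assumes n: "1 \<le> n"
  shows "distr M (\<Pi>\<^sub>M k\<in>upper_tri n. borel) (\<lambda>\<omega>. \<lambda>k\<in>upper_tri n. P (fst k) (snd k) \<omega>) =
    distr (diag_measure n \<Otimes>\<^sub>M off_measure n) (\<Pi>\<^sub>M k\<in>upper_tri n. borel)
      (\<lambda>x. \<lambda>k\<in>upper_tri n. scaled_matrix (fst x) (snd x) (fst k) (snd k))"
    (is "distr M ?B ?f = distr ?\<Omega> ?B ?g")
proof -
  have f: "?f \<in> measurable M ?B" and g: "?g \<in> measurable ?\<Omega> ?B"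
    using measurable_matrix_upper_tri measurable_scaled_matrix_upper_tri by blast+
  show ?thesis
  proof (rule measure_eqI_PiM_finite[where I = "upper_tri n" and M = "\<lambda>_. borel"])
    fix A :: "nat \<times> nat \<Rightarrow> real set"
    assume A: "\<And>k. k \<in> upper_tri n \<Longrightarrow> A k \<in> sets borel"
    have sets: "Pi\<^sub>E (upper_tri n) A \<in> sets ?B" using A by (intro sets_PiM_I_finite) auto
    have "emeasure (distr M ?B ?f) (Pi\<^sub>E (upper_tri n) A) =
      emeasure M {\<omega> \<in> space M. \<forall>k\<in>upper_tri n. P (fst k) (snd k) \<omega> \<in> A k}"
      unfolding emeasure_distr[OF f sets] by (intro arg_cong[of _ _ "emeasure M"]) (simp only: vimage_def Int_def mem_Collect_eq restrict_PiE_iff conj_commute)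
    also have "\<dots> = emeasure ?\<Omega> {x \<in> space ?\<Omega>. \<forall>k\<in>upper_tri n. scaled_matrix (fst x) (snd x) (fst k) (snd k) \<in> A k}"
      by (rule trans[OF emeasure_matrix_rect[OF n] emeasure_scaled_matrix_rect[symmetric]]) (erule A)+
    also have "\<dots> = emeasure (distr ?\<Omega> ?B ?g) (Pi\<^sub>E (upper_tri n) A)"
      unfolding emeasure_distr[OF g sets] by (intro arg_cong[of _ _ "emeasure ?\<Omega>"]) (simp only: vimage_def Int_def mem_Collect_eq restrict_PiE_iff conj_commute)
    finally show "emeasure (distr M ?B ?f) (Pi\<^sub>E (upper_tri n) A) = emeasure (distr ?\<Omega> ?B ?g) (Pi\<^sub>E (upper_tri n) A)" .
  next
    have "space ?B \<in> prod_algebra (upper_tri n) (\<lambda>_. borel :: real measure)"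
      unfolding space_PiM by (intro prod_algebraI_finite) auto
    then show "range (\<lambda>_::nat. space ?B) \<subseteq> prod_algebra (upper_tri n) (\<lambda>_. borel :: real measure)" by auto
    show "emeasure (distr M ?B ?f) (space ?B) \<noteq> \<infinity>"
      unfolding emeasure_distr[OF f sets.top] by (simp add: emeasure_eq_measure)
  qed auto
qed

text \<open>Both events are preimages of one measurable set \<open>E\<close> of triangular arrays,
  since symmetry recovers the whole matrix from its upper triangle; equality of the two laws on
  \<open>E\<close> finishes the argument.\<close>

lemma measure_best_level_less:
  assumes n: "3 \<le> n"
  shows "{x \<in> space (diag_measure n \<Otimes>\<^sub>M off_measure n).
      best_level2_bound n (scaled_matrix (fst x) (snd x)) < best_level1_bound n (scaled_matrix (fst x) (snd x))}
      \<in> sets (diag_measure n \<Otimes>\<^sub>M off_measure n)" (is "?E' \<in> sets ?\<Omega>")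
    and "emeasure M {\<omega> \<in> space M. best_level2_bound n (\<lambda>i j. P i j \<omega>) < best_level1_bound n (\<lambda>i j. P i j \<omega>)} =
      emeasure (diag_measure n \<Otimes>\<^sub>M off_measure n) {x \<in> space (diag_measure n \<Otimes>\<^sub>M off_measure n).
      best_level2_bound n (scaled_matrix (fst x) (snd x)) < best_level1_bound n (scaled_matrix (fst x) (snd x))}"
    (is "emeasure M ?E = _")
proof -
  let ?B = "\<Pi>\<^sub>M k\<in>upper_tri n. (borel :: real measure)"
  let ?s = "\<lambda>(y :: nat \<times> nat \<Rightarrow> real) i j. y (min i j, max i j)"
  let ?f = "\<lambda>\<omega>. \<lambda>k\<in>upper_tri n. P (fst k) (snd k) \<omega>"
  let ?g = "\<lambda>x. \<lambda>k\<in>upper_tri n. scaled_matrix (fst x) (snd x) (fst k) (snd k)"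
  define E where "E = {y \<in> space ?B. best_level2_bound n (?s y) < best_level1_bound n (?s y)}"
  have E: "E \<in> sets ?B"
    unfolding E_def
  proof (intro borel_measurable_less)
    have "(\<lambda>y. ?s y i j) \<in> borel_measurable ?B" if "i \<in> {1..n}" "j \<in> {1..n}" for i j
      using that by (intro measurable_component_singleton) (auto simp: upper_tri_def min_def max_def)
    then show "(\<lambda>y. best_level2_bound n (?s y)) \<in> borel_measurable ?B"
      "(\<lambda>y. best_level1_bound n (?s y)) \<in> borel_measurable ?B"
      using n by (intro measurable_best_level2_bound measurable_best_level1_bound; simp)+
  qed
  have f: "?f \<in> measurable M ?B" and g: "?g \<in> measurable ?\<Omega> ?B"
    using measurable_matrix_upper_tri measurable_scaled_matrix_upper_tri by blast+
  have "?f -` E \<inter> space M = ?E"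
  proof -
    have "?s (?f \<omega>) i j = P i j \<omega>" if "\<omega> \<in> space M" "i \<in> {1..n}" "j \<in> {1..n}" for \<omega> i j
      using that symmetric[of i j \<omega>] by (auto simp: upper_tri_def min_def max_def)
    then have "best_level2_bound n (?s (?f \<omega>)) = best_level2_bound n (\<lambda>i j. P i j \<omega>)"
      "best_level1_bound n (?s (?f \<omega>)) = best_level1_bound n (\<lambda>i j. P i j \<omega>)" if "\<omega> \<in> space M" for \<omega>
      using n that by (intro best_level2_bound_cong best_level1_bound_cong; simp)+
    then show ?thesis unfolding E_def using measurable_space[OF f] by auto
  qed
  moreover have gE: "?g -` E \<inter> space ?\<Omega> = ?E'"
  proof -
    have "?s (?g x) i j = scaled_matrix (fst x) (snd x) i j" if "i \<in> {1..n}" "j \<in> {1..n}" for x i j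
      using that by (auto simp: upper_tri_def min_def max_def scaled_matrix_def)
    then have "best_level2_bound n (?s (?g x)) = best_level2_bound n (scaled_matrix (fst x) (snd x))"
      "best_level1_bound n (?s (?g x)) = best_level1_bound n (scaled_matrix (fst x) (snd x))" for x
      using n by (intro best_level2_bound_cong best_level1_bound_cong; simp)+
    then show ?thesis unfolding E_def using measurable_space[OF g] by auto
  qed
  moreover have "emeasure (distr M ?B ?f) E = emeasure (distr ?\<Omega> ?B ?g) E"
    using distr_matrix n by simp
  ultimately show "emeasure M ?E = emeasure ?\<Omega> ?E'"
    by (simp only: emeasure_distr[OF f E] emeasure_distr[OF g E])
  show "?E' \<in> sets ?\<Omega>" using measurable_sets[OF g E] unfolding gE .
qed

end

section \<open>Probability estimates\<close>

lemma measure_unif_PiM_ball: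
  assumes "finite I" "J \<subseteq> I" "B \<in> sets borel"
  shows "measure (\<Pi>\<^sub>M i\<in>I. unif) {y \<in> space (\<Pi>\<^sub>M i\<in>I. unif). \<forall>k\<in>J. y k \<in> B} = measure unif B ^ card J"
proof -
  have "emeasure (\<Pi>\<^sub>M i\<in>I. unif) {y \<in> space (\<Pi>\<^sub>M i\<in>I. unif). \<forall>k\<in>J. y k \<in> B} = (\<Prod>k\<in>J. emeasure unif B)"
    by (rule product_prob_space.emeasure_PiM_Collect[OF product_prob_space_unif]) (use assms finite_subset in auto)
  also have "\<dots> = ennreal (measure unif B ^ card J)"
    by (simp add: unif.emeasure_eq_measure ennreal_power)
  finally show ?thesis by (simp add: measure_def)
qed

lemma sets_unif_PiM_ball:
  assumes "finite J" "J \<subseteq> I" "B \<in> sets borel"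
  shows "{y \<in> space (\<Pi>\<^sub>M i\<in>I. unif). \<forall>k\<in>J. y k \<in> B} \<in> sets (\<Pi>\<^sub>M i\<in>I. unif)"
proof (intro sets.sets_Collect_finite_All assms(1))
  fix k assume k: "k \<in> J"
  have [measurable]: "k \<in> I" "B \<in> sets borel" using k assms by auto
  show "{y \<in> space (\<Pi>\<^sub>M i\<in>I. unif). y k \<in> B} \<in> sets (\<Pi>\<^sub>M i\<in>I. unif)"
    by measurable
qed

lemma measure_pair_ge:
  assumes "prob_space N1" "prob_space N2"
    and A: "A \<in> sets (N1 \<Otimes>\<^sub>M N2)" and B: "B \<in> sets N1"
    and c: "\<And>x. x \<in> B \<Longrightarrow> c \<le> measure N2 (Pair x -` A)"
  shows "c * measure N1 B \<le> measure (N1 \<Otimes>\<^sub>M N2) A"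
proof -
  interpret N1: prob_space N1 by fact
  interpret N2: prob_space N2 by fact
  interpret N: prob_space "N1 \<Otimes>\<^sub>M N2" by (rule prob_space_pair) fact+
  have "ennreal (c * measure N1 B) \<le> ennreal c * emeasure N1 B"
    by (cases "0 \<le> c") (simp_all add: N1.emeasure_eq_measure ennreal_mult ennreal_neg mult_nonpos_nonneg)
  also have "\<dots> = (\<integral>\<^sup>+x. ennreal c * indicator B x \<partial>N1)"
    using B by (simp add: nn_integral_cmult_indicator)
  also have "\<dots> \<le> (\<integral>\<^sup>+x. emeasure N2 (Pair x -` A) \<partial>N1)"
    using c by (intro nn_integral_mono) (auto simp: indicator_def N2.emeasure_eq_measure intro!: ennreal_leI)
  also have "\<dots> = emeasure (N1 \<Otimes>\<^sub>M N2) A" by (rule N2.emeasure_pair_measure_alt[symmetric, OF A])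
  finally show ?thesis by (simp add: N.emeasure_eq_measure)
qed

text \<open>Fubini along a splitting of the index set, meant for the entries away from
  \<open>l\<close> as first block and the column of \<open>l\<close> as second.\<close>

lemma measure_unif_PiM_ge:
  assumes fin: "finite I" "finite J" "I \<inter> J = {}"
    and A: "A \<in> sets (\<Pi>\<^sub>M i\<in>I \<union> J. unif)" and B: "B \<in> sets (\<Pi>\<^sub>M i\<in>I. unif)"
    and c: "\<And>x. x \<in> B \<Longrightarrow> c \<le> measure (\<Pi>\<^sub>M i\<in>J. unif) {y \<in> space (\<Pi>\<^sub>M i\<in>J. unif). merge I J (x, y) \<in> A}"
  shows "c * measure (\<Pi>\<^sub>M i\<in>I. unif) B \<le> measure (\<Pi>\<^sub>M i\<in>I \<union> J. unif) A"
proof -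
  let ?I = "\<Pi>\<^sub>M i\<in>I. unif" and ?J = "\<Pi>\<^sub>M i\<in>J. unif"
  let ?A = "merge I J -` A \<inter> space (?I \<Otimes>\<^sub>M ?J)"
  have m: "merge I J \<in> measurable (?I \<Otimes>\<^sub>M ?J) (\<Pi>\<^sub>M i\<in>I \<union> J. unif)" by (rule measurable_merge)
  have "measure (\<Pi>\<^sub>M i\<in>I \<union> J. unif) A = measure (distr (?I \<Otimes>\<^sub>M ?J) (\<Pi>\<^sub>M i\<in>I \<union> J. unif) (merge I J)) A"
    using product_sigma_finite.distr_merge[OF product_sigma_finite_unif fin(3,1,2)] by simp
  also have "\<dots> = measure (?I \<Otimes>\<^sub>M ?J) ?A" by (rule measure_distr[OF m A])
  also have "\<dots> \<ge> c * measure ?I B"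
  proof (rule measure_pair_ge[OF prob_space_unif_PiM prob_space_unif_PiM _ B])
    show "?A \<in> sets (?I \<Otimes>\<^sub>M ?J)" using m A by (rule measurable_sets)
    fix x assume x: "x \<in> B"
    then have "Pair x -` ?A = {y \<in> space ?J. merge I J (x, y) \<in> A}"
      using sets.sets_into_space[OF B] by (auto simp: space_pair_measure)
    then show "c \<le> measure ?J (Pair x -` ?A)" using c[OF x] by simp
  qed
  finally show ?thesis .
qed

lemma indep_vars_unif_PiM:
  assumes "I \<noteq> {}"
  shows "prob_space.indep_vars (\<Pi>\<^sub>M i\<in>I. unif) (\<lambda>_. unif) (\<lambda>k y. y k) I"
proof -
  interpret prob_space "\<Pi>\<^sub>M i\<in>I. unif" by (rule prob_space_unif_PiM)
  have "distr (\<Pi>\<^sub>M i\<in>I. unif) (\<Pi>\<^sub>M i\<in>I. unif) (\<lambda>x. \<lambda>i\<in>I. x i) = distr (\<Pi>\<^sub>M i\<in>I. unif) (\<Pi>\<^sub>M i\<in>I. unif) (\<lambda>x. x)"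
    by (intro distr_cong) (auto simp: space_PiM PiE_restrict restrict_def PiE_def extensional_def)
  also have "\<dots> = (\<Pi>\<^sub>M i\<in>I. unif)" by simp
  also have "\<dots> = (\<Pi>\<^sub>M i\<in>I. distr (\<Pi>\<^sub>M i\<in>I. unif) unif (\<lambda>y. y i))"
    by (intro PiM_cong refl) (simp add: product_prob_space.PiM_component[OF product_prob_space_unif])
  finally show ?thesis using assms by (subst indep_vars_iff_distr_eq_PiM') auto
qed

text \<open>The blocks \<open>{f z, g z}\<close> are pairwise disjoint, so the conditions for
  different \<open>z\<close> are independent, and each holds with probability
  \<open>1 - (1 - t)^2\<close>.\<close>

lemma measure_unif_PiM_no_common:
  fixes f g :: "'z \<Rightarrow> 'i"
  assumes I: "finite I" and Z: "finite Z" "Z \<noteq> {}"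
    and fg: "f ` Z \<subseteq> I" "g ` Z \<subseteq> I" "inj_on f Z" "inj_on g Z" "f ` Z \<inter> g ` Z = {}"
    and t: "0 \<le> t" "t \<le> 1"
  shows "measure (\<Pi>\<^sub>M i\<in>I. unif) {y \<in> space (\<Pi>\<^sub>M i\<in>I. unif). \<forall>z\<in>Z. \<not> (t < y (f z) \<and> t < y (g z))} =
    (1 - (1 - t)\<^sup>2) ^ card Z"
proof -
  interpret prob_space "\<Pi>\<^sub>M i\<in>I. unif" by (rule prob_space_unif_PiM)
  let ?S = "space (\<Pi>\<^sub>M i\<in>I. unif)"
  let ?K = "\<lambda>z. {f z, g z}"
  let ?B = "\<lambda>z. {h \<in> space (\<Pi>\<^sub>M i\<in>?K z. unif). \<not> (\<forall>k\<in>?K z. h k \<in> {t<..})}"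
  have "I \<noteq> {}" using Z fg(1) by blast
  have "disjoint_family_on ?K Z"
    unfolding disjoint_family_on_def using fg(3-5) by (auto dest: inj_onD)
  then have ind: "indep_vars (\<lambda>z. \<Pi>\<^sub>M i\<in>?K z. unif) (\<lambda>z y. restrict (\<lambda>i. y i) (?K z)) Z"
    using fg(1,2) by (intro indep_vars_restrict[OF indep_vars_unif_PiM[OF \<open>I \<noteq> {}\<close>]]) auto
  have B: "?B z \<in> sets (\<Pi>\<^sub>M i\<in>?K z. unif)" if "z \<in> Z" for z
    by (rule sets.sets_Collect_neg) (rule sets_unif_PiM_ball, auto)
  have restr: "restrict y (?K z) \<in> space (\<Pi>\<^sub>M i\<in>?K z. unif)" for y :: "'i \<Rightarrow> real" and z by (simp add: space_PiM)
  have eq: "(\<lambda>y. restrict (\<lambda>i. y i) (?K z)) -` ?B z \<inter> ?S = ?S - {y \<in> ?S. \<forall>k\<in>?K z. y k \<in> {t<..}}" for z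
    using restr[of _ z] by auto
  have "{y \<in> ?S. \<forall>z\<in>Z. \<not> (t < y (f z) \<and> t < y (g z))} =
      (\<Inter>z\<in>Z. (\<lambda>y. restrict (\<lambda>i. y i) (?K z)) -` ?B z \<inter> ?S)"
    unfolding eq using Z(2) by auto
  also have "prob \<dots> = (\<Prod>z\<in>Z. prob ((\<lambda>y. restrict (\<lambda>i. y i) (?K z)) -` ?B z \<inter> ?S))"
    using B by (intro indep_varsD_finite[OF ind Z(2,1)])
  also have "\<dots> = (\<Prod>z\<in>Z. 1 - (1 - t)\<^sup>2)"
  proof (intro prod.cong refl)
    fix z assume z: "z \<in> Z"
    have sub: "?K z \<subseteq> I" using fg(1,2) z by auto
    have "f z \<noteq> g z" using fg(5) z by blast
    then have "prob {y \<in> ?S. \<forall>k\<in>?K z. y k \<in> {t<..}} = (1 - t)\<^sup>2"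
      using measure_unif_PiM_ball[OF I sub, of "{t<..}"] measure_unif_greaterThan[OF t] by (simp add: power2_eq_square)
    moreover have "{y \<in> ?S. \<forall>k\<in>?K z. y k \<in> {t<..}} \<in> sets (\<Pi>\<^sub>M i\<in>I. unif)"
      by (rule sets_unif_PiM_ball) (use sub in auto)
    ultimately show "prob ((\<lambda>y. restrict (\<lambda>i. y i) (?K z)) -` ?B z \<inter> ?S) = 1 - (1 - t)\<^sup>2"
      unfolding eq by (subst prob_compl) auto
  qed
  finally show ?thesis by simp
qed

section \<open>Heavy common neighbours and the top two entries of a column\<close>

abbreviation upair :: "nat \<Rightarrow> nat \<Rightarrow> nat \<times> nat" where
  "upair x y \<equiv> (min x y, max x y)"

lemma upair_eq_iff: "upair x y = upair x' y' \<longleftrightarrow> x = x' \<and> y = y' \<or> x = y' \<and> y = x'"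
  by (auto simp: min_def max_def)

lemma upair_off_diag: "x \<in> {1..n} \<Longrightarrow> y \<in> {1..n} \<Longrightarrow> x \<noteq> y \<Longrightarrow> upair x y \<in> off_diag n"
  by (auto simp: off_diag_def min_def max_def)

definition off_diag_at :: "nat \<Rightarrow> nat \<Rightarrow> (nat \<times> nat) set" where
  "off_diag_at n l = (\<lambda>x. upair x l) ` ({1..n} - {l})"

text \<open>Once the diagonal is fixed, these coordinates alone determine the weights among the
  indices other than \<open>l\<close>, and hence the tree on them.\<close>

definition off_diag_avoid :: "nat \<Rightarrow> nat \<Rightarrow> (nat \<times> nat) set" where
  "off_diag_avoid n l = off_diag n - off_diag_at n l"

lemma off_diag_at_subset: "l \<in> {1..n} \<Longrightarrow> off_diag_at n l \<subseteq> off_diag n"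
  unfolding off_diag_at_def using upair_off_diag by (intro image_subsetI) (metis Diff_iff singletonI)

lemma off_diag_split:
  assumes "l \<in> {1..n}"
  shows "off_diag n = off_diag_avoid n l \<union> off_diag_at n l" "off_diag_avoid n l \<inter> off_diag_at n l = {}"
    "finite (off_diag_avoid n l)" "finite (off_diag_at n l)"
  using off_diag_at_subset[OF assms] finite_subset[OF _ finite_off_diag[of n]]
  unfolding off_diag_avoid_def by blast+

lemma upair_off_diag_avoid:
  assumes "x \<in> {1..n} - {l}" "y \<in> {1..n} - {l}" "x \<noteq> y"
  shows "upair x y \<in> off_diag_avoid n l"
  using assms upair_off_diag[of x n y] unfolding off_diag_avoid_def off_diag_at_def
  by (auto simp: upair_eq_iff simp del: prod.inject)

text \<open>The existence of a common neighbour is written with a double negation so that the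
  complement is visibly a union, over pairs, of events of known probability.\<close>

definition heavy_event :: "nat \<Rightarrow> nat \<Rightarrow> real \<Rightarrow> (nat \<times> nat \<Rightarrow> real) set" where
  "heavy_event n l t = {u \<in> space (\<Pi>\<^sub>M k\<in>off_diag_avoid n l. unif).
     \<forall>x\<in>{1..n} - {l}. \<forall>y\<in>{1..n} - {l}. x \<noteq> y \<longrightarrow>
       \<not> (\<forall>z\<in>{1..n} - {l, x, y}. \<not> (t < u (upair x z) \<and> t < u (upair y z)))}"

text \<open>Union bound over at most \<open>n^2\<close> ordered pairs. For one pair the
  \<open>n - 3\<close> candidates \<open>z\<close> use disjoint coordinates, and
  \<open>4 \<le> n\<close> leaves at least one candidate.\<close>

lemma measure_heavy_event:
  assumes n: "4 \<le> n" and l: "l \<in> {1..n}" and t: "0 \<le> t" "t \<le> 1"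
  shows "heavy_event n l t \<in> sets (\<Pi>\<^sub>M k\<in>off_diag_avoid n l. unif)"
    and "1 - real n ^ 2 * (1 - (1 - t)\<^sup>2) ^ (n - 3) \<le> measure (\<Pi>\<^sub>M k\<in>off_diag_avoid n l. unif) (heavy_event n l t)"
proof -
  let ?N = "\<Pi>\<^sub>M k\<in>off_diag_avoid n l. unif"
  let ?R = "{1..n} - {l}"
  let ?I = "{(x, y). x \<in> ?R \<and> y \<in> ?R \<and> x \<noteq> y}"
  let ?F = "\<lambda>(x, y). {u \<in> space ?N. \<forall>z\<in>{1..n} - {l, x, y}. \<not> (t < u (upair x z) \<and> t < u (upair y z))}"
  interpret N: prob_space ?N by (rule prob_space_unif_PiM)
  have fin: "finite ?I" by (rule finite_subset[of _ "?R \<times> ?R"]) auto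
  have F: "?F p \<in> sets ?N" if p: "p \<in> ?I" for p
  proof -
    obtain x y where xy: "p = (x, y)" "x \<in> ?R" "y \<in> ?R" "x \<noteq> y" using p by auto
    have "{u \<in> space ?N. \<not> (t < u (upair x z) \<and> t < u (upair y z))} \<in> sets ?N" if z: "z \<in> {1..n} - {l, x, y}" for z
    proof -
      have [measurable]: "upair x z \<in> off_diag_avoid n l" "upair y z \<in> off_diag_avoid n l"
        using xy z by (auto intro!: upair_off_diag_avoid)
      show ?thesis by measurable
    qed
    then show ?thesis unfolding xy(1) split by (intro sets.sets_Collect_finite_All) auto
  qed
  have prob: "N.prob (?F p) = (1 - (1 - t)\<^sup>2) ^ (n - 3)" if p: "p \<in> ?I" for p
  proof -
    obtain x y where xy: "p = (x, y)" "x \<in> ?R" "y \<in> ?R" "x \<noteq> y" using p by auto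
    let ?Z = "{1..n} - {l, x, y}"
    have card: "card ?Z = n - 3"
      using l xy by (subst card_Diff_subset) auto
    have "card ?Z \<noteq> 0" using card n by simp
    then have ne: "?Z \<noteq> {}" by (metis card.empty)
    have "N.prob {u \<in> space ?N. \<forall>z\<in>?Z. \<not> (t < u (upair x z) \<and> t < u (upair y z))} = (1 - (1 - t)\<^sup>2) ^ card ?Z"
    proof (rule measure_unif_PiM_no_common[OF _ _ ne _ _ _ _ _ t])
      show "(\<lambda>z. upair x z) ` ?Z \<subseteq> off_diag_avoid n l" "(\<lambda>z. upair y z) ` ?Z \<subseteq> off_diag_avoid n l"
        using xy upair_off_diag_avoid by blast+
      show "inj_on (\<lambda>z. upair x z) ?Z" "inj_on (\<lambda>z. upair y z) ?Z"
        by (auto intro!: inj_onI simp: upair_eq_iff simp del: prod.inject)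
      show "(\<lambda>z. upair x z) ` ?Z \<inter> (\<lambda>z. upair y z) ` ?Z = {}"
        using xy(4) by (auto simp: upair_eq_iff simp del: prod.inject)
    qed (use off_diag_split(3)[OF l] in auto)
    then show ?thesis unfolding xy(1) split card .
  qed
  have eq: "heavy_event n l t = space ?N - (\<Union>p\<in>?I. ?F p)"
    unfolding heavy_event_def by blast
  have U: "(\<Union>p\<in>?I. ?F p) \<in> sets ?N" using fin F by (intro sets.finite_UN) auto
  then show "heavy_event n l t \<in> sets ?N" unfolding eq by auto
  have q: "0 \<le> 1 - (1 - t)\<^sup>2" using t by (simp add: power_le_one)
  have "N.prob (\<Union>p\<in>?I. ?F p) \<le> (\<Sum>p\<in>?I. N.prob (?F p))"
    using fin F by (intro N.finite_measure_subadditive_finite) auto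
  also have "\<dots> = real (card ?I) * (1 - (1 - t)\<^sup>2) ^ (n - 3)" using prob by simp
  also have "\<dots> \<le> real n ^ 2 * (1 - (1 - t)\<^sup>2) ^ (n - 3)"
  proof (intro mult_right_mono)
    have "card ?I \<le> card ({1..n} \<times> {1..n})" by (intro card_mono) auto
    then show "real (card ?I) \<le> real n ^ 2" by (simp add: power2_eq_square flip: of_nat_mult)
  qed (use q in simp)
  finally show "1 - real n ^ 2 * (1 - (1 - t)\<^sup>2) ^ (n - 3) \<le> N.prob (heavy_event n l t)"
    unfolding eq using N.prob_compl[OF U] by simp
qed

text \<open>For a two-element \<open>e\<close>, its members hold the two top places in the column of
  \<open>l\<close>. Ties count as membership, so the complement supplies a strict
  inequality.\<close>

definition top_event :: "nat \<Rightarrow> nat \<Rightarrow> nat set \<Rightarrow> (nat \<times> nat \<Rightarrow> real) set" where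
  "top_event n l e = {u \<in> space (\<Pi>\<^sub>M k\<in>off_diag_at n l. unif).
     \<forall>c\<in>{1..n} - {l} - e. \<forall>a\<in>e. u (upair c l) \<le> u (upair a l)}"

text \<open>If some entry outside \<open>e\<close> exceeds \<open>1 - g\<close> then so do both entries in \<open>e\<close>. The bound
  is later used with \<open>g = n powr (-2/3)\<close>, which makes it \<open>o(1/n)\<close>.\<close>

lemma measure_top_event:
  assumes l: "l \<in> {1..n}" and e: "e \<subseteq> {1..n} - {l}" "card e = 2" and g: "0 \<le> g" "g \<le> 1"
  shows "top_event n l e \<in> sets (\<Pi>\<^sub>M k\<in>off_diag_at n l. unif)"
    and "measure (\<Pi>\<^sub>M k\<in>off_diag_at n l. unif) (top_event n l e) \<le> (1 - g) ^ (n - 3) + g\<^sup>2"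
proof -
  let ?N = "\<Pi>\<^sub>M k\<in>off_diag_at n l. unif"
  let ?c = "\<lambda>x. upair x l"
  let ?R = "{1..n} - {l}"
  interpret N: prob_space ?N by (rule prob_space_unif_PiM)
  have fin: "finite (off_diag_at n l)" by (rule off_diag_split(4)[OF l])
  have fe: "finite e" using e(2) by (intro card_ge_0_finite) simp
  have inj: "inj_on ?c A" for A by (auto intro!: inj_onI simp: upair_eq_iff simp del: prod.inject)
  have sub: "?c ` A \<subseteq> off_diag_at n l" if "A \<subseteq> ?R" for A using that by (auto simp: off_diag_at_def)
  show "top_event n l e \<in> sets ?N"
    unfolding top_event_def
  proof (intro sets.sets_Collect_finite_All fe)
    fix c a assume ca: "c \<in> ?R - e" "a \<in> e"
    have [measurable]: "?c c \<in> off_diag_at n l" "?c a \<in> off_diag_at n l" using ca e(1) sub[of ?R] by blast+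
    show "{u \<in> space ?N. u (?c c) \<le> u (?c a)} \<in> sets ?N" by measurable
  qed simp
  let ?A1 = "{u \<in> space ?N. \<forall>k\<in>?c ` (?R - e). u k \<in> {..1 - g}}"
  let ?A2 = "{u \<in> space ?N. \<forall>k\<in>?c ` e. u k \<in> {1 - g<..}}"
  have s: "?c ` (?R - e) \<subseteq> off_diag_at n l" "?c ` e \<subseteq> off_diag_at n l"
    using sub[OF Diff_subset] sub[OF e(1)] by blast+
  have "?A1 \<in> sets ?N" by (rule sets_unif_PiM_ball[OF _ s(1)]) simp_all
  moreover have "?A2 \<in> sets ?N" by (rule sets_unif_PiM_ball[OF _ s(2)]) (simp_all add: fe)
  ultimately have A: "?A1 \<in> sets ?N" "?A2 \<in> sets ?N" .
  have "top_event n l e \<subseteq> ?A1 \<union> ?A2"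
  proof
    fix u assume u: "u \<in> top_event n l e"
    show "u \<in> ?A1 \<union> ?A2"
    proof (rule ccontr)
      assume neg: "u \<notin> ?A1 \<union> ?A2"
      have "u \<in> space ?N" using u unfolding top_event_def by blast
      with neg obtain c a where ca: "c \<in> ?R - e" "u (?c c) \<notin> {..1 - g}" "a \<in> e" "u (?c a) \<notin> {1 - g<..}"
        by blast
      then have "u (?c c) \<le> u (?c a)" using u unfolding top_event_def by blast
      with ca(2,4) show False by simp
    qed
  qed
  then have "N.prob (top_event n l e) \<le> N.prob (?A1 \<union> ?A2)" using A by (intro N.finite_measure_mono) auto
  also have "\<dots> \<le> N.prob ?A1 + N.prob ?A2" using A by (intro measure_Un_le)
  also have "N.prob ?A1 = (1 - g) ^ (n - 3)"
  proof -
    have "N.prob ?A1 = measure unif {..1 - g} ^ card (?c ` (?R - e))"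
      by (rule measure_unif_PiM_ball[OF fin s(1)]) simp
    moreover have "card (?c ` (?R - e)) = n - 3"
      using card_image[OF inj, of "?R - e"] card_Diff_subset[OF fe e(1)] e(2) l by simp
    ultimately show ?thesis using measure_unif_atMost[of "1 - g"] g by simp
  qed
  also have "N.prob ?A2 = g\<^sup>2"
  proof -
    have "N.prob ?A2 = measure unif {1 - g<..} ^ card (?c ` e)"
      by (rule measure_unif_PiM_ball[OF fin s(2)]) simp
    then show ?thesis using measure_unif_greaterThan[of "1 - g"] g card_image[OF inj, of e] e(2) by simp
  qed
  finally show "N.prob (top_event n l e) \<le> (1 - g) ^ (n - 3) + g\<^sup>2" by simp
qed

section \<open>Isolation of the smallest diagonal entry\<close>

definition gap_event :: "nat \<Rightarrow> real \<Rightarrow> nat \<Rightarrow> (nat \<Rightarrow> real) set" where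
  "gap_event n r l = {d \<in> space (diag_measure n). 0 < d l \<and> (\<forall>x\<in>{1..n} - {l}. r * d l < d x)}"

lemma sets_gap_event:
  assumes [measurable]: "l \<in> {1..n}"
  shows "gap_event n r l \<in> sets (diag_measure n)"
proof -
  have "{d \<in> space (diag_measure n). r * d l < d x} \<in> sets (diag_measure n)" if "x \<in> {1..n} - {l}" for x
  proof -
    have [measurable]: "x \<in> {1..n}" using that by auto
    show ?thesis by measurable
  qed
  moreover have "{d \<in> space (diag_measure n). 0 < d l} \<in> sets (diag_measure n)" by measurable
  ultimately show ?thesis unfolding gap_event_def
    by (intro sets.sets_Collect_conj sets.sets_Collect_finite_All) auto
qed

lemma gap_event_disjoint:
  assumes "1 \<le> r"
  shows "disjoint_family_on (gap_event n r) {1..n}"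
  unfolding disjoint_family_on_def
proof (intro ballI impI equals0I)
  fix l x d assume lx: "l \<in> {1..n}" "x \<in> {1..n}" "l \<noteq> x" and d: "d \<in> gap_event n r l \<inter> gap_event n r x"
  then have "r * d l < d x" "r * d x < d l" "0 < d l" "0 < d x" unfolding gap_event_def by auto
  moreover have "d l \<le> r * d l" "d x \<le> r * d x"
    using assms calculation mult_right_mono[of 1 r "d l"] mult_right_mono[of 1 r "d x"] by auto
  ultimately show False by linarith
qed

text \<open>Given \<open>d l = p\<close>, the other \<open>n - 1\<close> entries exceed
  \<open>r p\<close> with probability \<open>(1 - r p)^(n - 1)\<close>; integration over
  \<open>p\<close> up to \<open>1 / r\<close> yields \<open>1 / (r n)\<close>. The events for
  different \<open>l\<close> are disjoint, so together they contribute \<open>1 / r\<close>.\<close>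

lemma measure_gap_event:
  assumes l: "l \<in> {1..n}" and r: "1 \<le> r"
  shows "1 / (r * real n) \<le> measure (diag_measure n) (gap_event n r l)"
proof -
  let ?R = "{1..n} - {l}"
  let ?A = "gap_event n r l"
  have n: "1 \<le> n" using l by auto
  have split: "{1..n} = {l} \<union> ?R" using l by auto
  \<comment> \<open>A lower bound for the section at \<open>p = d l\<close>: zero is excluded as the
    event demands \<open>0 < d l\<close>, and beyond \<open>1 / r\<close> the base of the power
    would be negative.\<close>
  define h where "h p = ennreal ((1 - r * p) ^ (n - 1)) * indicator {0<..1 / r} p" for p :: real
  have [measurable]: "h \<in> borel_measurable borel" unfolding h_def by measurable
  have A: "?A \<in> sets (\<Pi>\<^sub>M i\<in>{l} \<union> ?R. unif)" using sets_gap_event[OF l] unfolding split[symmetric] .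
  have "(\<integral>\<^sup>+p. h p \<partial>unif) = (\<integral>\<^sup>+x. h (x l) \<partial>(\<Pi>\<^sub>M i\<in>{l}. unif))"
    by (rule product_sigma_finite.product_nn_integral_singleton[OF product_sigma_finite_unif, symmetric]) simp
  also have "\<dots> \<le> (\<integral>\<^sup>+x. emeasure (\<Pi>\<^sub>M i\<in>?R. unif) ((\<lambda>y. merge {l} ?R (x, y)) -` ?A \<inter> space (\<Pi>\<^sub>M i\<in>?R. unif)) \<partial>(\<Pi>\<^sub>M i\<in>{l}. unif))"
  proof (rule nn_integral_mono)
    fix x assume x: "x \<in> space (\<Pi>\<^sub>M i\<in>{l}. unif)"
    show "h (x l) \<le> emeasure (\<Pi>\<^sub>M i\<in>?R. unif) ((\<lambda>y. merge {l} ?R (x, y)) -` ?A \<inter> space (\<Pi>\<^sub>M i\<in>?R. unif))"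
    proof (cases "x l \<in> {0<..1 / r}")
      case True
      then have p: "0 < x l" "0 \<le> r * x l" "r * x l \<le> 1" using r by (auto simp: field_simps)
      have "(\<lambda>y. merge {l} ?R (x, y)) -` ?A \<inter> space (\<Pi>\<^sub>M i\<in>?R. unif) =
          {y \<in> space (\<Pi>\<^sub>M i\<in>?R. unif). \<forall>k\<in>?R. y k \<in> {r * x l<..}}"
        using p(1) l by (auto simp: gap_event_def space_PiM merge_def PiE_iff extensional_def)
      moreover have "emeasure (\<Pi>\<^sub>M i\<in>?R. unif) {y \<in> space (\<Pi>\<^sub>M i\<in>?R. unif). \<forall>k\<in>?R. y k \<in> {r * x l<..}} =
          ennreal ((1 - r * x l) ^ (n - 1))"
        using measure_unif_PiM_ball[of ?R ?R "{r * x l<..}"] measure_unif_greaterThan[OF p(2,3)] l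
        by (simp add: finite_measure.emeasure_eq_measure[OF prob_space.finite_measure[OF prob_space_unif_PiM]])
      ultimately show ?thesis using True by (simp add: h_def)
    qed (simp add: h_def)
  qed
  also have "\<dots> = emeasure (\<Pi>\<^sub>M i\<in>{l} \<union> ?R. unif) ?A"
    by (rule product_sigma_finite.emeasure_fold_integral[OF product_sigma_finite_unif, symmetric]) (use A in auto)
  also have "\<dots> = ennreal (measure (diag_measure n) ?A)"
    unfolding split[symmetric]
    by (rule finite_measure.emeasure_eq_measure[OF prob_space.finite_measure[OF prob_space_unif_PiM]])
  finally have le: "(\<integral>\<^sup>+p. h p \<partial>unif) \<le> ennreal (measure (diag_measure n) ?A)" .
  have "(\<integral>\<^sup>+p. h p \<partial>unif) = (\<integral>\<^sup>+p. h p * indicator {0..1} p \<partial>lborel)"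
    unfolding unif_def by (subst nn_integral_uniform_measure) (auto simp: divide_ennreal_def)
  also have "\<dots> = (\<integral>\<^sup>+p. ennreal ((1 - r * p) ^ (n - 1)) * indicator {0..1 / r} p \<partial>lborel)"
  proof (rule nn_integral_cong_AE)
    have r1: "1 / r \<le> 1" using r by simp
    show "AE p in lborel. h p * indicator {0..1} p = ennreal ((1 - r * p) ^ (n - 1)) * indicator {0..1 / r} p"
      using AE_lborel_singleton[of "0::real"] by eventually_elim (use r1 in \<open>auto simp: h_def indicator_def\<close>)
  qed
  also have "\<dots> = ennreal (- ((1 - r * (1 / r)) ^ n) / (r * real n) - (- ((1 - r * 0) ^ n) / (r * real n)))"
  proof (rule nn_integral_FTC_Icc[where F = "\<lambda>p. - ((1 - r * p) ^ n) / (r * real n)"])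
    fix p :: real assume p: "p \<in> {0..1 / r}"
    show "((\<lambda>p. - ((1 - r * p) ^ n) / (r * real n)) has_real_derivative (1 - r * p) ^ (n - 1)) (at p)"
      using r n by (auto intro!: derivative_eq_intros simp: field_simps)
    show "0 \<le> (1 - r * p) ^ (n - 1)" using p r by (intro zero_le_power) (simp add: field_simps)
  qed (use r in auto)
  also have "\<dots> = ennreal (1 / (r * real n))" using r n by (simp add: power_0_left)
  finally show ?thesis using le by (simp add: ennreal_le_iff)
qed

section \<open>Combination of the events\<close>

lemma max_spanning_tree_cong:
  assumes "max_spanning_tree w V T"
    and "\<And>x y. x \<in> V \<Longrightarrow> y \<in> V \<Longrightarrow> x \<noteq> y \<Longrightarrow> w' {x, y} = w {x, y}"
  shows "max_spanning_tree w' V T"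
proof -
  have "sum w' T = sum w T" if tree: "spanning_tree V T" for T
  proof (rule sum.cong[OF refl])
    fix e assume "e \<in> T"
    then obtain x y where "x \<in> V" "y \<in> V" "x \<noteq> y" "e = {x, y}"
      using tree unfolding spanning_tree_def by blast
    then show "w' e = w e" using assms(2) by blast
  qed
  then show ?thesis using assms(1) unfolding max_spanning_tree_def by simp
qed

lemma scaled_matrix_commute: "scaled_matrix d v i j = scaled_matrix d v j i"
  by (simp add: scaled_matrix_def min.commute max.commute)

text \<open>The deterministic core: on the gap event, the heavy event and the complement of the top
  events, the comparison of the two bounds applies with threshold \<open>m = d l\<close>. The tree
  is computed from \<open>u\<close> alone and carried over to the full array
  \<open>v\<close>.\<close>

lemma gap_heavy_best_level_less:
  assumes n: "3 \<le> n" and l: "l \<in> {1..n}" and r: "1 < r"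
    and d: "d \<in> gap_event n r l" and u: "u \<in> heavy_event n l (1 / r)"
    and vu: "\<And>k. k \<in> off_diag_avoid n l \<Longrightarrow> v k = u k"
    and vy: "\<And>k. k \<in> off_diag_at n l \<Longrightarrow> v k = y k"
    and y: "y \<in> space (\<Pi>\<^sub>M k\<in>off_diag_at n l. unif)" "\<And>k. k \<in> off_diag_at n l \<Longrightarrow> y k \<le> 1"
    and T: "max_spanning_tree (edge_weight (scaled_matrix d u)) ({1..n} - {l}) T"
    and top: "y \<notin> (\<Union>e\<in>T. top_event n l e)"
  shows "best_level2_bound n (scaled_matrix d v) < best_level1_bound n (scaled_matrix d v)"
proof (rule best_level2_less_best_level1[where l = l and m = "d l" and T' = T, OF n l scaled_matrix_commute])
  let ?R = "{1..n} - {l}" and ?X = "scaled_matrix d v"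
  have dl: "0 < d l" and dx: "\<And>x. x \<in> ?R \<Longrightarrow> r * d l < d x"
    using d unfolding gap_event_def by auto
  have "d l < r * d l" using dl r by simp
  \<comment> \<open>The gap makes \<open>d l\<close> the smaller diagonal entry, so the column of
    \<open>l\<close> is ordered in the same way as \<open>y\<close>.\<close>
  then have Xl: "?X x l = d l * y (upair x l)" if "x \<in> ?R" for x
    using dx[OF that] vy[of "upair x l"] that by (auto simp: scaled_matrix_def off_diag_at_def)
  have Xu: "?X x z = min (d x) (d z) * u (upair x z)" "scaled_matrix d u x z = ?X x z"
    if "x \<in> ?R" "z \<in> ?R" "x \<noteq> z" for x z
    using vu[OF upair_off_diag_avoid[OF that]] that(3) by (auto simp: scaled_matrix_def)
  show "max_spanning_tree (edge_weight ?X) ?R T"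
    by (rule max_spanning_tree_cong[OF T])
      (simp add: edge_weight_doubleton scaled_matrix_commute Xu(2))
  show "?X x l \<le> d l" if x: "x \<in> ?R" for x
  proof -
    have "upair x l \<in> off_diag_at n l" using x by (auto simp: off_diag_at_def)
    then show ?thesis using Xl[OF x] y(2)[of "upair x l"] dl by (simp add: mult_left_le)
  qed
  show "\<exists>z\<in>?R. ?X x z > d l \<and> ?X x' z > d l" if xx': "x \<in> ?R" "x' \<in> ?R" "x \<noteq> x'" for x x'
  proof -
    obtain z where z: "z \<in> {1..n} - {l, x, x'}" "1 / r < u (upair x z)" "1 / r < u (upair x' z)"
      using u xx' unfolding heavy_event_def by blast
    have gt: "d l < ?X a z" if a: "a \<in> ?R" "a \<noteq> z" "1 / r < u (upair a z)" for a
    proof -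
      have zR: "z \<in> ?R" using z(1) by auto
      have "0 < r * d l" using dl r by simp
      then have "0 < d a" "0 < d z" using dx[OF a(1)] dx[OF zR] by linarith+
      \<comment> \<open>The factor \<open>r\<close> of the gap cancels the threshold
        \<open>1 / r\<close> of the heavy event and leaves exactly \<open>d l\<close>.\<close>
      then have "r * d l * (1 / r) < min (d a) (d z) * u (upair a z)"
        using dx[OF a(1)] dx[OF zR] a(3) dl r by (intro mult_strict_mono) auto
      then show ?thesis using Xu(1)[OF a(1) zR a(2)] r by simp
    qed
    have "z \<in> ?R" "x \<noteq> z" "x' \<noteq> z" using z(1) by auto
    then show ?thesis using gt[OF xx'(1) _ z(2)] gt[OF xx'(2) _ z(3)] by blast
  qed
  show "\<exists>c\<in>{1..n} - {l, a, b}. ?X c l > ?X a l \<or> ?X c l > ?X b l" if ab: "{a, b} \<in> T" for a b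
  proof -
    have "spanning_tree ?R T" using T unfolding max_spanning_tree_def by blast
    from spanning_tree_edgeD(1,2)[OF this ab] have R: "a \<in> ?R" "b \<in> ?R" .
    have "y \<notin> top_event n l {a, b}" using top ab by blast
    then obtain c x where c: "c \<in> ?R - {a, b}" "x \<in> {a, b}" "\<not> y (upair c l) \<le> y (upair x l)"
      using y(1) unfolding top_event_def by blast
    then have "?X x l < ?X c l" using Xl[of c] Xl[of x] R dl by auto
    moreover have "c \<in> {1..n} - {l, a, b}" using c(1) by blast
    ultimately show ?thesis using c(2) by blast
  qed
qed

text \<open>With \<open>d\<close> and \<open>u\<close> fixed the tree is fixed too, while the column
  \<open>y\<close> is still uniform; only the top events of the edges of that tree have to be
  avoided.\<close>

lemma measure_best_level_less_slice:
  assumes n: "4 \<le> n" and l: "l \<in> {1..n}" and r: "1 < r" and g: "0 \<le> g" "g \<le> 1"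
    and d: "d \<in> gap_event n r l" and u: "u \<in> heavy_event n l (1 / r)"
    and E: "{v \<in> space (off_measure n). best_level2_bound n (scaled_matrix d v) < best_level1_bound n (scaled_matrix d v)}
      \<in> sets (off_measure n)" (is "?E \<in> _")
  shows "1 - real n * ((1 - g) ^ (n - 3) + g\<^sup>2) \<le> measure (\<Pi>\<^sub>M k\<in>off_diag_at n l. unif)
    {y \<in> space (\<Pi>\<^sub>M k\<in>off_diag_at n l. unif). merge (off_diag_avoid n l) (off_diag_at n l) (u, y) \<in> ?E}"
    (is "1 - ?\<epsilon> \<le> measure ?N ?G")
proof -
  let ?R = "{1..n} - {l}" and ?m = "merge (off_diag_avoid n l) (off_diag_at n l)"
  interpret N: prob_space ?N by (rule prob_space_unif_PiM)
  note split = off_diag_split[OF l]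
  have ne: "?R \<noteq> {}"
  proof
    assume "?R = {}"
    then have "card {1..n} \<le> card {l}" by (intro card_mono) auto
    then show False using n by simp
  qed
  obtain T where T: "max_spanning_tree (edge_weight (scaled_matrix d u)) ?R T"
    using max_spanning_tree_exists[OF _ ne] by blast
  then have tree: "spanning_tree ?R T" unfolding max_spanning_tree_def by blast
  have finT: "finite T" using spanning_tree_finite[OF tree] by simp
  have "Suc (card T) = card ?R" using tree unfolding spanning_tree_def by blast
  also have "card ?R \<le> card {1..n}" by (intro card_mono) auto
  \<comment> \<open>The number of terms in the union bound is linear in \<open>n\<close>, so a bound
    \<open>o(1/n)\<close> for a single edge suffices.\<close>
  finally have cardT: "card T \<le> n" by simp
  let ?U = "\<Union>e\<in>T. top_event n l e"
  have e: "e \<subseteq> ?R" "card e = 2" if "e \<in> T" for e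
    using tree that unfolding spanning_tree_def by (fastforce simp: card_2_iff)+
  have U: "?U \<in> sets ?N" using finT measure_top_event(1)[OF l e g] by blast
  have \<epsilon>: "N.prob ?U \<le> ?\<epsilon>"
  proof -
    have "N.prob ?U \<le> (\<Sum>e\<in>T. N.prob (top_event n l e))"
      using finT measure_top_event(1)[OF l e g] by (intro N.finite_measure_subadditive_finite) auto
    also have "\<dots> \<le> (\<Sum>e\<in>T. (1 - g) ^ (n - 3) + g\<^sup>2)"
      using measure_top_event(2)[OF l e g] by (intro sum_mono) auto
    also have "\<dots> = real (card T) * ((1 - g) ^ (n - 3) + g\<^sup>2)" by simp
    also have "\<dots> \<le> ?\<epsilon>" using cardT g by (intro mult_right_mono) auto
    finally show ?thesis .
  qed
  \<comment> \<open>The space of \<open>unif\<close> is the whole line, so the upper bound 1 on the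
    factors holds only almost surely and is imposed as an event of probability 1.\<close>
  let ?L = "{y \<in> space ?N. \<forall>k\<in>off_diag_at n l. y k \<in> {..1}}"
  have L: "?L \<in> sets ?N" by (rule sets_unif_PiM_ball) (use split in auto)
  have uS: "u \<in> space (\<Pi>\<^sub>M k\<in>off_diag_avoid n l. unif)" using u unfolding heavy_event_def by blast
  have merge: "?m (u, y) \<in> space (off_measure n)" if "y \<in> space ?N" for y
    using measurable_space[OF measurable_merge, of "(u, y)" "off_diag_avoid n l" "\<lambda>_. unif" "off_diag_at n l"]
      uS that unfolding split(1) by (simp add: space_pair_measure)
  have G: "?G \<in> sets ?N"
  proof -
    have "?m \<in> measurable ((\<Pi>\<^sub>M k\<in>off_diag_avoid n l. unif) \<Otimes>\<^sub>M ?N) (off_measure n)"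
      unfolding split(1) by (rule measurable_merge)
    from measurable_Pair2[OF this uS]
    have "(\<lambda>y. ?m (u, y)) \<in> measurable ?N (off_measure n)" .
    from measurable_sets[OF this E] show ?thesis by (simp add: vimage_def Int_def conj_commute)
  qed
  have "?L - ?U \<subseteq> ?G"
  proof
    fix y assume y: "y \<in> ?L - ?U"
    have "best_level2_bound n (scaled_matrix d (?m (u, y))) < best_level1_bound n (scaled_matrix d (?m (u, y)))"
    proof (rule gap_heavy_best_level_less[OF _ l r d u _ _ _ _ T, where y = y])
      show "?m (u, y) k = u k" if "k \<in> off_diag_avoid n l" for k using that by (simp add: merge_def)
      show "?m (u, y) k = y k" if "k \<in> off_diag_at n l" for k using that split(2) by (auto simp: merge_def)
    qed (use n y in auto)
    then show "y \<in> ?G" using merge y by blast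
  qed
  then have "?L \<subseteq> ?G \<union> ?U" by blast
  then have "N.prob ?L \<le> N.prob (?G \<union> ?U)" using G U by (intro N.finite_measure_mono) auto
  also have "\<dots> \<le> N.prob ?G + N.prob ?U" using G U by (intro measure_Un_le)
  finally have "N.prob ?L \<le> N.prob ?G + ?\<epsilon>" using \<epsilon> by linarith
  moreover have "N.prob ?L = measure unif {..1} ^ card (off_diag_at n l)"
    by (rule measure_unif_PiM_ball[OF split(4)]) auto
  ultimately show ?thesis using measure_unif_atMost[of 1] by simp
qed

text \<open>The factors are the three stages of conditioning: \<open>1 / r\<close> for some gap
  event of the diagonal, \<open>1 - \<kappa>\<close> for the heavy event,
  \<open>1 - \<epsilon>\<close> for the column of \<open>l\<close>. The index \<open>l\<close> is
  read off from the diagonal, so it is constant in the inner two stages.\<close>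

lemma (in random_matrix) measure_best_level_less_ge:
  fixes r g :: real
  defines "\<epsilon> \<equiv> real n * ((1 - g) ^ (n - 3) + g\<^sup>2)"
  defines "\<kappa> \<equiv> real n ^ 2 * (1 - (1 - 1 / r)\<^sup>2) ^ (n - 3)"
  assumes n: "4 \<le> n" and r: "1 < r" and g: "0 \<le> g" "g \<le> 1" and small: "\<epsilon> \<le> 1" "\<kappa> \<le> 1"
  shows "(1 - \<epsilon>) * (1 - \<kappa>) / r \<le>
    measure M {\<omega> \<in> space M. best_level2_bound n (\<lambda>i j. P i j \<omega>) < best_level1_bound n (\<lambda>i j. P i j \<omega>)}"
proof -
  let ?\<Omega> = "diag_measure n \<Otimes>\<^sub>M off_measure n"
  let ?E = "{x \<in> space ?\<Omega>. best_level2_bound n (scaled_matrix (fst x) (snd x)) < best_level1_bound n (scaled_matrix (fst x) (snd x))}"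
  let ?D = "\<Union>l\<in>{1..n}. gap_event n r l"
  have n3: "3 \<le> n" using n by simp
  have E: "?E \<in> sets ?\<Omega>" using measure_best_level_less(1)[OF n3] .
  have D: "?D \<in> sets (diag_measure n)" using sets_gap_event by blast
  interpret D: prob_space "diag_measure n" by (rule prob_space_unif_PiM)
  have "(1 - \<epsilon>) * (1 - \<kappa>) * measure (diag_measure n) ?D \<le> measure ?\<Omega> ?E"
  proof (rule measure_pair_ge[OF prob_space_unif_PiM prob_space_unif_PiM E D])
    fix d assume "d \<in> ?D"
    then obtain l where l: "l \<in> {1..n}" and d: "d \<in> gap_event n r l" by blast
    let ?Ed = "{v \<in> space (off_measure n). best_level2_bound n (scaled_matrix d v) < best_level1_bound n (scaled_matrix d v)}"
    note split = off_diag_split[OF l]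
    have "d \<in> space (diag_measure n)" using d unfolding gap_event_def by blast
    then have Ed: "Pair d -` ?E = ?Ed" by (auto simp: space_pair_measure)
    have Eds: "?Ed \<in> sets (off_measure n)" using sets_Pair1[OF E, of d] unfolding Ed .
    have t: "0 \<le> 1 / r" "1 / r \<le> 1" using r by auto
    note heavy = measure_heavy_event[OF n l t]
    have "(1 - \<epsilon>) * (1 - \<kappa>) \<le> (1 - \<epsilon>) * measure (\<Pi>\<^sub>M k\<in>off_diag_avoid n l. unif) (heavy_event n l (1 / r))"
      using small(1) heavy(2) unfolding \<kappa>_def by (intro mult_left_mono) auto
    also have "\<dots> \<le> measure (\<Pi>\<^sub>M k\<in>off_diag_avoid n l \<union> off_diag_at n l. unif) ?Ed"
    proof (rule measure_unif_PiM_ge[OF split(3,4,2) _ heavy(1)])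
      show "?Ed \<in> sets (\<Pi>\<^sub>M k\<in>off_diag_avoid n l \<union> off_diag_at n l. unif)"
        using Eds unfolding split(1)[symmetric] .
    qed (unfold \<epsilon>_def, rule measure_best_level_less_slice[OF n l r g d _ Eds])
    also have "\<dots> = measure (off_measure n) (Pair d -` ?E)" unfolding split(1)[symmetric] Ed ..
    finally show "(1 - \<epsilon>) * (1 - \<kappa>) \<le> measure (off_measure n) (Pair d -` ?E)" .
  qed
  moreover have "1 / r \<le> measure (diag_measure n) ?D"
  proof -
    have "1 / r = (\<Sum>l\<in>{1..n}. 1 / (r * real n))" using n r by simp
    also have "\<dots> \<le> (\<Sum>l\<in>{1..n}. measure (diag_measure n) (gap_event n r l))"
      using measure_gap_event r by (intro sum_mono) auto
    also have "\<dots> = measure (diag_measure n) ?D"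
      using gap_event_disjoint[of r n] r sets_gap_event
      by (intro D.finite_measure_finite_Union[symmetric]) auto
    finally show ?thesis .
  qed
  then have "(1 - \<epsilon>) * (1 - \<kappa>) * (1 / r) \<le> (1 - \<epsilon>) * (1 - \<kappa>) * measure (diag_measure n) ?D"
    using small by (intro mult_left_mono) auto
  moreover have "measure M {\<omega> \<in> space M. best_level2_bound n (\<lambda>i j. P i j \<omega>) < best_level1_bound n (\<lambda>i j. P i j \<omega>)} =
      measure ?\<Omega> ?E"
    unfolding measure_def measure_best_level_less(2)[OF n3] ..
  ultimately show ?thesis by simp
qed

text \<open>The first summand behaves like \<open>n exp (- n powr (1/3))\<close>, the second equals
  \<open>n powr (- 1/3)\<close>. With \<open>g = n powr (- c)\<close>, any \<open>c\<close> strictly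
  between 1/2 and 1 would balance the two.\<close>

lemma top_error_tendsto:
  defines "g \<equiv> \<lambda>n. real n powr (- 2 / 3)"
  shows "(\<lambda>n. real n * ((1 - g n) ^ (n - 3) + (g n)\<^sup>2)) \<longlonglongrightarrow> 0"
proof (rule LIMSEQ_offset[where k = 3])
  have "(\<lambda>m. real (m + 3) * (1 - g (m + 3)) powr real m + real (m + 3) * (g (m + 3))\<^sup>2) \<longlonglongrightarrow> 0"
    unfolding g_def by real_asymp
  moreover have "(1 - g (m + 3)) powr real m = (1 - g (m + 3)) ^ m" for m
  proof (rule powr_realpow)
    have "g (m + 3) < real (m + 3) powr 0" unfolding g_def by (intro powr_less_mono) auto
    then show "0 < 1 - g (m + 3)" by simp
  qed
  ultimately show "(\<lambda>m. real (m + 3) * ((1 - g (m + 3)) ^ (m + 3 - 3) + (g (m + 3))\<^sup>2)) \<longlonglongrightarrow> 0"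
    by (simp add: distrib_left)
qed

lemma heavy_error_tendsto:
  fixes q :: real
  assumes "0 < q" "q < 1"
  shows "(\<lambda>n. real n ^ 2 * q ^ (n - 3)) \<longlonglongrightarrow> 0"
proof (rule LIMSEQ_offset[where k = 3])
  have "(\<lambda>m. real (m + 3) ^ 2 * q ^ m) \<longlonglongrightarrow> 0" using assms by real_asymp
  then show "(\<lambda>m. real (m + 3) ^ 2 * q ^ (m + 3 - 3)) \<longlonglongrightarrow> 0" by simp
qed

theorem theorem5:
  fixes M :: "nat \<Rightarrow> 'a measure"
    and P :: "nat \<Rightarrow> nat \<Rightarrow> nat \<Rightarrow> 'a \<Rightarrow> real"
  assumes "\<And>n. n \<ge> 3 \<Longrightarrow> random_matrix (M n) n (P n)"
  shows "(\<lambda>n. measure (M n)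
            {\<omega> \<in> space (M n).
               best_level2_bound n (\<lambda>i j. P n i j \<omega>) < best_level1_bound n (\<lambda>i j. P n i j \<omega>)})
         \<longlonglongrightarrow> 1" (is "?p \<longlonglongrightarrow> 1")
proof (rule order_tendstoI)
  have "?p n \<le> 1" if "3 \<le> n" for n
  proof -
    interpret random_matrix "M n" n "P n" by (rule assms[OF that])
    show ?thesis by (rule prob_le_1)
  qed
  then show "\<forall>\<^sub>F n in sequentially. ?p n < a" if "1 < a" for a
    using that by (intro eventually_mono[OF eventually_ge_at_top[of 3]]) (rule le_less_trans)
next
  fix a :: real assume a: "a < 1"
  \<comment> \<open>For positive \<open>a\<close> this places \<open>1 / r\<close> at the midpoint
    of \<open>a\<close> and 1; for other \<open>a\<close>, where \<open>1 + a\<close> may fail to be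
    positive, \<open>1 / r = 1/2\<close> already exceeds \<open>a\<close>.\<close>
  define r where "r = (if a \<le> 0 then 2 else 2 / (1 + a))"
  have r: "1 < r" "a < 1 / r" using a by (auto simp: r_def field_simps)
  define g where "g n = real n powr (- 2 / 3)" for n
  define \<epsilon> where "\<epsilon> n = real n * ((1 - g n) ^ (n - 3) + (g n)\<^sup>2)" for n
  define \<kappa> where "\<kappa> n = real n ^ 2 * (1 - (1 - 1 / r)\<^sup>2) ^ (n - 3)" for n
  have \<epsilon>: "\<epsilon> \<longlonglongrightarrow> 0" unfolding \<epsilon>_def g_def by (rule top_error_tendsto)
  have "0 < 1 - 1 / r" "1 - 1 / r < 1" using r by auto
  then have "0 < (1 - 1 / r)\<^sup>2" "(1 - 1 / r)\<^sup>2 < 1" by (auto simp: power_less_one_iff abs_square_less_1)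
  then have \<kappa>: "\<kappa> \<longlonglongrightarrow> 0" unfolding \<kappa>_def by (intro heavy_error_tendsto) auto
  have "(\<lambda>n. (1 - \<epsilon> n) * (1 - \<kappa> n) / r) \<longlonglongrightarrow> (1 - 0) * (1 - 0) / r"
    using r(1) by (intro tendsto_intros \<epsilon> \<kappa>) auto
  then have "\<forall>\<^sub>F n in sequentially. a < (1 - \<epsilon> n) * (1 - \<kappa> n) / r"
    using r(2) by (intro order_tendstoD(1)) auto
  moreover have "\<forall>\<^sub>F n in sequentially. \<epsilon> n < 1" "\<forall>\<^sub>F n in sequentially. \<kappa> n < 1"
    using order_tendstoD(2)[OF \<epsilon>] order_tendstoD(2)[OF \<kappa>] by auto
  ultimately show "\<forall>\<^sub>F n in sequentially. a < ?p n"
    using eventually_ge_at_top[of 4]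
  proof eventually_elim
    case (elim n)
    interpret random_matrix "M n" n "P n" using elim by (intro assms) auto
    have "g n \<le> real n powr 0" unfolding g_def using elim by (intro powr_mono) auto
    then have "0 \<le> g n" "g n \<le> 1" using elim by (auto simp: g_def)
    then have "(1 - \<epsilon> n) * (1 - \<kappa> n) / r \<le> ?p n"
      using measure_best_level_less_ge[of r "g n"] elim r(1) unfolding \<epsilon>_def \<kappa>_def by auto
    then show ?case using elim by linarith
  qed
qed

end
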